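(* Let $M$ be a matroid of rank $r$ without coloops, and let $(h_0,\dots,h_r)$ be the $h$-vector of its independence complex $\Delta(M)$. Then: (1) $h_0\le h_1\le\dots\le h_{\lfloor r/2\rfloor}$; (2) $h_i\le h_{r-i}$ for all $i\le r/2$; (3) setting $g_i=h_i-h_{i-1}$, one has $g_{i+1}\le g_i^{\langle i\rangle}$ for all $i$ with $1\le i<r/2$.
   Context: The independence complex $\Delta(M)$ is the simplicial complex whose vertices are the non-loop elements of the ground set and whose faces are the independent sets; it has dimension $r-1$. If $f_j$ denotes the number of faces of cardinality $j$ ($f_0=1$), the $h$-vector is defined by $h_i=\sum_{j=0}^{i}(-1)^{i+j}f_j\binom{r-j}{i-j}$ for $0\le i\le r$. For integers $i,j>0$, write uniquely $j=\binom{a_i}{i}+\binom{a_{i-1}}{i-1}+\dots+\binom{a_l}{l}$ with $a_i>a_{i-1}>\dots>a_l\ge l\ge 1$, and set $j^{\langle i\rangle}=\binom{a_i+1}{i+1}+\binom{a_{i-1}+1}{i}+\dots+\binom{a_l+1}{l+1}$; by convention $0^{\langle i\rangle}=0$. *)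

theory Defs
  imports Complex_Main
begin

section \<open>Finite matroids\<close>

locale matroid =
  fixes E :: "'a set" and indep :: "'a set \<Rightarrow> bool"
  assumes finite_ground: "finite E"
    and indep_subset_ground: "indep X \<Longrightarrow> X \<subseteq> E"
    and indep_empty: "indep {}"
    and indep_subset: "indep X \<Longrightarrow> Y \<subseteq> X \<Longrightarrow> indep Y"
    and augmentation: "indep X \<Longrightarrow> indep Y \<Longrightarrow> card X < card Y \<Longrightarrow> \<exists>e\<in>Y - X. indep (insert e X)"

definition matroid_basis :: "('a set \<Rightarrow> bool) \<Rightarrow> 'a set \<Rightarrow> bool" where
  "matroid_basis indep B \<longleftrightarrow> indep B \<and> (\<forall>X. indep X \<and> B \<subseteq> X \<longrightarrow> X = B)"

definition matroid_rank :: "('a set \<Rightarrow> bool) \<Rightarrow> nat" where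
  "matroid_rank indep = Max (card ` {X. indep X})"

definition coloop :: "'a set \<Rightarrow> ('a set \<Rightarrow> bool) \<Rightarrow> 'a \<Rightarrow> bool" where
  "coloop E indep e \<longleftrightarrow> e \<in> E \<and> (\<forall>B. matroid_basis indep B \<longrightarrow> e \<in> B)"

section \<open>The independence complex and its \<open>h\<close>-vector\<close>

text \<open>A simplicial complex is given by its set of faces, the empty face included; its vertices
  are the \<open>v\<close> such that \<open>{v}\<close> is a face, here the non-loops of the matroid.\<close>

definition independence_complex :: "('a set \<Rightarrow> bool) \<Rightarrow> 'a set set" where
  "independence_complex indep = {X. indep X}"

text \<open>As in the formula for the \<open>h\<close>-vector, \<open>f\<close> is indexed by cardinality, not by dimension.\<close>

definition f_vector :: "'a set set \<Rightarrow> nat \<Rightarrow> nat" where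
  "f_vector K j = card {F \<in> K. card F = j}"

text \<open>Here \<open>r\<close> is the dimension of \<open>K\<close> plus one. Only the indices \<open>i \<le> r\<close> are meaningful, and for
  those no subtraction below is truncated.\<close>

definition h_vector :: "nat \<Rightarrow> 'a set set \<Rightarrow> nat \<Rightarrow> int" where
  "h_vector r K i =
     (\<Sum>j=0..i. (-1) ^ (i + j) * int (f_vector K j) * int ((r - j) choose (i - j)))"

section \<open>Macaulay's pseudo-powers\<close>

text \<open>\<open>macaulay_rep i j l a\<close> says that \<open>j\<close> is the sum of the \<open>a k choose k\<close> for \<open>k = i, \<dots>, l\<close>,
  where \<open>a i > \<dots> > a l \<ge> l \<ge> 1\<close>. Values of \<open>a\<close> outside \<open>{l..i}\<close> are irrelevant.\<close>

definition macaulay_rep :: "nat \<Rightarrow> nat \<Rightarrow> nat \<Rightarrow> (nat \<Rightarrow> nat) \<Rightarrow> bool" where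
  "macaulay_rep i j l a \<longleftrightarrow>
     1 \<le> l \<and> l \<le> i \<and> l \<le> a l \<and> (\<forall>k\<in>{l..<i}. a k < a (Suc k)) \<and>
     j = (\<Sum>k=l..i. a k choose k)"

text \<open>\<open>pseudo_power j i\<close> is \<open>j\<^sup>\<langle>\<^sup>i\<^sup>\<rangle>\<close>; see below for the existence and uniqueness of the
  representation.\<close>

definition pseudo_power :: "nat \<Rightarrow> nat \<Rightarrow> nat" where
  "pseudo_power j i =
     (if j = 0 then 0
      else THE m. \<exists>l a. macaulay_rep i j l a \<and> m = (\<Sum>k=l..i. (a k + 1) choose (k + 1)))"

lemma macaulay_rep_cases:
  assumes "macaulay_rep i j l a"
  obtains "i = l" "1 \<le> l" "l \<le> a l" "j = a i choose i"
  | i' j' where "i = Suc i'" "l \<le> i'" "macaulay_rep i' j' l a" "a i' < a i"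
      "j = j' + (a i choose i)"
proof (cases "i = l")
  case True
  then show ?thesis using that(1) assms by (auto simp: macaulay_rep_def)
next
  case False
  with assms obtain i' where i': "i = Suc i'" "l \<le> i'"
    by (cases i) (auto simp: macaulay_rep_def)
  show ?thesis
  proof (rule that(2)[OF i', of "\<Sum>k=l..i'. a k choose k"])
    show "macaulay_rep i' (\<Sum>k=l..i'. a k choose k) l a"
      using assms i' by (auto simp: macaulay_rep_def)
    show "a i' < a i" "j = (\<Sum>k=l..i'. a k choose k) + (a i choose i)"
      using assms i' by (auto simp: macaulay_rep_def)
  qed
qed

lemma macaulay_rep_bounds:
  "macaulay_rep i j l a \<Longrightarrow>
     1 \<le> i \<and> i \<le> a i \<and> 0 < j \<and> a i choose i \<le> j \<and> j < Suc (a i) choose i"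
proof (induction i arbitrary: j)
  case 0
  then show ?case by (auto simp: macaulay_rep_def)
next
  case (Suc i)
  from Suc.prems show ?case
  proof (cases rule: macaulay_rep_cases)
    case 1
    then have "Suc i \<le> a (Suc i)" by simp
    with 1(4) show ?thesis by simp
  next
    case (2 i' j')
    have IH: "1 \<le> i" "i \<le> a i" "0 < j'" "j' < Suc (a i) choose i"
      using Suc.IH[of j'] 2 by auto
    moreover have "Suc (a i) choose i \<le> a (Suc i) choose i"
      using 2 by (intro binomial_right_mono) auto
    ultimately show ?thesis using 2 by auto
  qed
qed

lemma macaulay_rep_unique:
  "macaulay_rep i j l a \<Longrightarrow> macaulay_rep i j l' b \<Longrightarrow> l = l' \<and> (\<forall>k\<in>{l..i}. a k = b k)"
proof (induction i arbitrary: j)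
  case 0
  then show ?case by (auto simp: macaulay_rep_def)
next
  case (Suc i)
  have le: "c (Suc i) \<le> d (Suc i)"
    if "macaulay_rep (Suc i) j m c" "macaulay_rep (Suc i) j m' d" for m c m' d
  proof (rule ccontr)
    assume "\<not> ?thesis"
    then have "Suc (d (Suc i)) choose Suc i \<le> c (Suc i) choose Suc i"
      by (intro binomial_right_mono) auto
    with macaulay_rep_bounds[OF that(1)] macaulay_rep_bounds[OF that(2)] show False by linarith
  qed
  have eq: "a (Suc i) = b (Suc i)"
    using le[OF Suc.prems] le[OF Suc.prems(2,1)] by simp
  from Suc.prems(1) show ?case
  proof (cases rule: macaulay_rep_cases)
    case 1
    note a = 1
    from Suc.prems(2) show ?thesis
    proof (cases rule: macaulay_rep_cases)
      case 1
      then have "l = Suc i" "l' = Suc i" using a(1) by simp_all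
      with eq show ?thesis by simp
    next
      case (2 i' j')
      show ?thesis using a(4) 2(5) eq macaulay_rep_bounds[OF 2(3)] by simp
    qed
  next
    case (2 i' j')
    note a = 2
    from Suc.prems(2) show ?thesis
    proof (cases rule: macaulay_rep_cases)
      case 1
      show ?thesis using 1(4) a(5) eq macaulay_rep_bounds[OF a(3)] by simp
    next
      case (2 i'' j'')
      have "j' = j''" using a(5) 2(5) eq by simp
      then have "l = l'" "\<forall>k\<in>{l..i}. a k = b k"
        using Suc.IH[of j'] a(1,3) 2(1,3) by simp_all
      with eq show ?thesis by (auto simp: le_Suc_eq)
    qed
  qed
qed

lemma macaulay_rep_exists:
  "1 \<le> i \<Longrightarrow> 0 < j \<Longrightarrow> \<exists>l a. macaulay_rep i j l a"
proof (induction i arbitrary: j)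
  case 0
  then show ?case by simp
next
  case (Suc i)
  have bound: "n \<le> i + j" if "n choose Suc i \<le> j" for n
  proof (rule ccontr)
    assume "\<not> ?thesis"
    then have "Suc (i + j) choose Suc i \<le> n choose Suc i"
      by (intro binomial_right_mono) auto
    moreover have "Suc j \<le> Suc (i + j) choose Suc i"
    proof (induction i)
      case (Suc i)
      then show ?case by simp
    qed simp
    ultimately show False using that by simp
  qed
  define n where "n = (GREATEST n. n choose Suc i \<le> j)"
  have n: "n choose Suc i \<le> j"
    unfolding n_def
    by (rule GreatestI_nat[where P = "\<lambda>n. n choose Suc i \<le> j" and k = 0 and b = "i + j"])
       (use bound in auto)
  have greatest: "m \<le> n" if "m choose Suc i \<le> j" for m
    unfolding n_def
    by (rule Greatest_le_nat[where P = "\<lambda>n. n choose Suc i \<le> j" and b = "i + j"])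
       (use bound that in auto)
  have n_ge: "Suc i \<le> n"
    by (rule greatest) (use Suc.prems in auto)
  have lt: "j < Suc n choose Suc i"
    using greatest[of "Suc n"] by force
  show ?case
  proof (cases "j = n choose Suc i")
    case True
    with n_ge have "macaulay_rep (Suc i) j (Suc i) (\<lambda>_. n)"
      by (simp add: macaulay_rep_def)
    then show ?thesis by blast
  next
    case False
    define j' where "j' = j - (n choose Suc i)"
    have j': "0 < j'" "j = j' + (n choose Suc i)" "j' < n choose i"
      using n False lt by (auto simp: j'_def)
    have "i \<noteq> 0" using j'(1,3) by (cases i) auto
    then obtain l a where a: "macaulay_rep i j' l a"
      using Suc.IH[of j'] j' by auto
    have "a i < n"
    proof (rule ccontr)
      assume "\<not> ?thesis"
      then have "n choose i \<le> a i choose i" by (intro binomial_right_mono) auto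
      with macaulay_rep_bounds[OF a] j' show False by simp
    qed
    moreover have "(\<Sum>k=l..i. (a(Suc i := n)) k choose k) = (\<Sum>k=l..i. a k choose k)"
      by (rule sum.cong) auto
    ultimately have "macaulay_rep (Suc i) j l (a(Suc i := n))"
      using a j' by (auto simp: macaulay_rep_def less_Suc_eq)
    then show ?thesis by blast
  qed
qed

lemma pseudo_power_eq:
  assumes "macaulay_rep i j l a"
  shows "pseudo_power j i = (\<Sum>k=l..i. (a k + 1) choose (k + 1))"
proof -
  have "(THE m. \<exists>l a. macaulay_rep i j l a \<and> m = (\<Sum>k=l..i. (a k + 1) choose (k + 1))) =
      (\<Sum>k=l..i. (a k + 1) choose (k + 1))"
  proof (rule the_equality)
    fix m
    assume "\<exists>l a. macaulay_rep i j l a \<and> m = (\<Sum>k=l..i. (a k + 1) choose (k + 1))"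
    then obtain l' b where b: "macaulay_rep i j l' b"
      "m = (\<Sum>k=l'..i. (b k + 1) choose (k + 1))" by blast
    from macaulay_rep_unique[OF assms b(1)] b(2)
    show "m = (\<Sum>k=l..i. (a k + 1) choose (k + 1))" by (auto intro!: sum.cong)
  qed (use assms in blast)
  then show ?thesis
    using macaulay_rep_bounds[OF assms] by (simp add: pseudo_power_def)
qed

end

theory Submission
  imports Defs "HOL-Library.Function_Algebras" "HOL-Library.Multiset" "HOL-Library.FuncSet"
    "HOL-Computational_Algebra.Polynomial"
begin

text \<open>Following Swartz, the \<open>g\<close>-vector is compared with the Hilbert function of the face ring modulo
  \<open>r + 1\<close> linear forms, which is dualised to a stress space: a space of functions on monomials on
  which the variables act by lowering the degree. A series class \<open>S\<close> that is independent splits the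
  faces into those that avoid \<open>S\<close>, again the faces of a coloop-free matroid of rank \<open>r\<close>, and the star
  of \<open>S\<close>, which is governed by the contraction of \<open>S\<close>. Both the \<open>h\<close>-vector and the upper bounds for
  stress spaces add up along this splitting, so by induction everything reduces to direct sums of
  circuits. There the stress space is the kernel of the lowering operator of an \<open>sl\<^sub>2\<close>-representation.

  The bounds give that \<open>g\<close> is nonnegative in the lower half. They are sharp, and the growth of stress
  spaces is restricted by Macaulay's theorem. Its proof works with dimensions only: setting a variable
  to zero and dividing by it gives a recursion, and the resulting numerical inequality is one about
  initial segments of the colexicographic order.\<close>

text \<open>The obstacle is that one choice of linear forms must serve both parts of every
  splitting. On the dual side only upper bounds are required, and such a bound follows from a finite
  set of monomials that detects every nonzero stress. Detecting sets for the two parts can be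
  united, and a detecting set for one choice of forms keeps working at all but finitely many points
  of any line through that choice; exact sequences and regular sequences never have to be produced.
  Lower bounds come from counting, since the Hilbert function of the face ring is read off from the
  faces. Of the \<open>r + 1\<close> forms, \<open>r\<close> play the part of a system of parameters
  and the last one that of a Lefschetz element. Series classes are the right pieces because, without
  coloops, any proper part of a class can be added to an independent set disjoint from the class. In
  a direct sum of circuits, identifying the variables of each circuit turns the face ring into a
  tensor product of truncated polynomial rings, where the Lefschetz property is accessible by
  hand.\<close>

section \<open>Initial segments of the colexicographic order\<close>

text \<open>The number of \<open>k\<close>-subsets of \<open>{0, \<dots>, n}\<close> that contain \<open>0\<close>, among the first \<open>s\<close> ones in the
  colexicographic order. It is meaningful for \<open>s \<le> Suc n choose k\<close>. For
  \<open>s = (\<Sum>j. a j choose j)\<close>, a \<open>k\<close>-th Macaulay representation, its value is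
  \<open>\<Sum>j. (a j - 1) choose (j - 1)\<close>.\<close>

fun colex_count :: "nat \<Rightarrow> nat \<Rightarrow> nat \<Rightarrow> nat" where
  "colex_count 0 k s = (if k = 1 then min 1 s else 0)"
| "colex_count (Suc n) 0 s = 0"
| "colex_count (Suc n) (Suc k) s =
     (if s \<le> Suc n choose Suc k then colex_count n (Suc k) s
      else colex_count n (Suc k) (Suc n choose Suc k) +
           colex_count n k (s - (Suc n choose Suc k)))"

lemma colex_count_0 [simp]: "colex_count n 0 s = 0"
  by (cases n) auto

lemma colex_count_zero [simp]: "colex_count n k 0 = 0"
  by (induction n arbitrary: k) (auto, metis colex_count.simps(3) colex_count_0 le0 not0_implies_Suc)

lemma colex_count_append:
  assumes "z \<le> Suc n choose k"
  shows "colex_count (Suc n) (Suc k) ((Suc n choose Suc k) + z) =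
    colex_count n (Suc k) (Suc n choose Suc k) + colex_count n k z"
  using assms by simp

lemma colex_count_Suc:
  assumes "s \<le> Suc n choose k"
  shows "colex_count (Suc n) k s = colex_count n k s"
  using assms by (cases k) auto

lemma colex_count_stable:
  assumes "n \<le> n'" and "s \<le> Suc n choose k"
  shows "colex_count n' k s = colex_count n k s"
  using assms
proof (induction n' rule: dec_induct)
  case (step p)
  have "Suc n choose k \<le> Suc p choose k"
    using step by (intro binomial_right_mono) auto
  then show ?case
    using step by (subst colex_count_Suc) auto
qed auto

lemma colex_count_full: "colex_count n (Suc k) (Suc n choose Suc k) = n choose k"
proof (induction n arbitrary: k)
  case 0
  then show ?case by (cases k) auto
next
  case (Suc n)
  have "colex_count (Suc n) (Suc k) (Suc (Suc n) choose Suc k) =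
      (n choose k) + colex_count n k (Suc n choose k)"
    using colex_count_append[of "Suc n choose k" n k] Suc[of k]
    by (simp only: binomial_Suc_Suc[of "Suc n"] add.commute)
  then show ?case
    using Suc[of "k - 1"] by (cases k) (simp_all del: colex_count.simps)
qed

lemma colex_count_le: "colex_count n k s \<le> s"
proof (induction n arbitrary: k s)
  case (Suc n)
  show ?case
  proof (cases k)
    case (Suc k')
    show ?thesis
      using Suc.IH[of "Suc k'" s] Suc.IH[of "Suc k'" "Suc n choose Suc k'"]
        Suc.IH[of k' "s - (Suc n choose Suc k')"] Suc
      by (auto simp del: binomial_Suc_Suc)
  qed auto
qed auto

lemma colex_count_mono:
  assumes "s \<le> t"
  shows "colex_count n k s \<le> colex_count n k t"
  using assms
proof (induction n arbitrary: k s t)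
  case (Suc n)
  show ?case
  proof (cases k)
    case (Suc k')
    show ?thesis
    proof (cases "t \<le> Suc n choose k")
      case True
      then show ?thesis using Suc Suc.IH Suc.prems by (simp del: binomial_Suc_Suc)
    next
      case False
      have "colex_count n k (min s (Suc n choose k)) \<le> colex_count n k (Suc n choose k)"
        using Suc.IH by auto
      moreover have "colex_count n k' (s - (Suc n choose k)) \<le> colex_count n k' (t - (Suc n choose k))"
        using Suc.IH Suc.prems by auto
      ultimately show ?thesis
        using False Suc by (auto simp: min_def simp del: binomial_Suc_Suc)
    qed
  qed auto
qed auto

text \<open>Complementation reverses the colexicographic order.\<close>

lemma colex_count_complement:
  assumes "k \<le> Suc n" and "s \<le> Suc n choose k"
  shows "colex_count n k (Suc n choose k) + colex_count n (Suc n - k) s =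
    s + colex_count n k ((Suc n choose k) - s)"
  using assms
proof (induction n arbitrary: k s)
  case 0
  then consider "k = 0" "s = 0" | "k = 0" "s = 1" | "k = 1" "s = 0" | "k = 1" "s = 1"
    by (cases k; cases s) auto
  then show ?case by cases auto
next
  case (Suc n)
  consider "k = 0" | "k = Suc (Suc n)" | k' where "k = Suc k'" "k' \<le> n"
    using Suc.prems by (cases k) (auto simp: le_Suc_eq)
  then show ?case
  proof cases
    case 1
    then have "s = 0 \<or> s = 1" using Suc.prems by auto
    then show ?thesis
    proof
      assume "s = 1"
      moreover have "colex_count (Suc n) (Suc (Suc n)) 1 = 1"
        using colex_count_full[of "Suc n" "Suc n"] by simp
      ultimately show ?thesis using 1 by simp
    qed auto
  next
    case 2
    then have "s = 0 \<or> s = 1" using Suc.prems by auto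
    then show ?thesis
      using colex_count_full[of "Suc n" "Suc n"] 2
      by (auto simp del: colex_count.simps)
  next
    case 3
    \<comment> \<open>\<open>c\<close> counts the \<open>k\<close>-subsets that avoid the top
      element \<open>n + 1\<close>, \<open>d\<close> those that contain it. Complementation makes
      the two groups change places, hence the case split at \<open>d\<close> below.\<close>
    define c where "c = Suc n choose Suc k'"
    define d where "d = Suc n choose k'"
    have sd: "d = Suc n choose (Suc n - k')" and sc: "c = Suc n choose (n - k')"
      using 3 binomial_symmetric[of k' "Suc n"] binomial_symmetric[of "Suc k'" "Suc n"]
      by (auto simp: c_def d_def simp del: binomial_Suc_Suc)
    have cd: "Suc (Suc n) choose k = c + d" using 3 by (simp add: c_def d_def)
    have k2: "Suc (Suc n) - k = Suc (n - k')" "Suc n - k' = Suc (n - k')" "Suc n - Suc k' = n - k'"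
      using 3 by auto
    have full: "colex_count (Suc n) k (c + d) = colex_count n (Suc k') c + colex_count n k' d"
      using colex_count_append[of d n k'] 3 by (simp add: c_def d_def del: binomial_Suc_Suc)
    have IH1: "colex_count n k' d + colex_count n (Suc (n - k')) t = t + colex_count n k' (d - t)"
      if "t \<le> d" for t
      using Suc.IH[of k' t] 3 that by (simp add: d_def k2 del: binomial_Suc_Suc)
    have IH2: "colex_count n (Suc k') c + colex_count n (n - k') t = t + colex_count n (Suc k') (c - t)"
      if "t \<le> c" for t
      using Suc.IH[of "Suc k'" t] 3 that by (simp add: c_def del: binomial_Suc_Suc)
    show ?thesis
    proof (cases "s \<le> d")
      case True
      have "colex_count (Suc n) k (c + d - s) = colex_count n (Suc k') c + colex_count n k' (d - s)"
        using colex_count_append[of "d - s" n k'] True 3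
        by (simp add: c_def d_def del: binomial_Suc_Suc colex_count.simps)
      moreover have "colex_count (Suc n) (Suc (n - k')) s = colex_count n (Suc (n - k')) s"
        using True sd by (intro colex_count_Suc) (simp add: k2)
      ultimately show ?thesis
        unfolding cd k2 full using IH1[OF True] by simp
    next
      case False
      then obtain t where t: "s = d + t" "t \<le> c"
        using Suc.prems(2) unfolding cd by (metis add.commute add_le_cancel_left le_iff_add linear)
      have "colex_count (Suc n) k (c - t) = colex_count n (Suc k') (c - t)"
        using 3 by (simp only: , intro colex_count_Suc) (simp add: c_def del: binomial_Suc_Suc)
      moreover have "colex_count (Suc n) (Suc (n - k')) (d + t) =
          colex_count n (Suc (n - k')) d + colex_count n (n - k') t"
        using colex_count_append[of t n "n - k'"] sc sd t(2) by (simp add: k2 del: binomial_Suc_Suc)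
      moreover have "c + d - s = c - t" using t by simp
      ultimately show ?thesis
        unfolding cd k2 full using IH1[of d] IH2[OF t(2)] t by simp
    qed
  qed
qed

definition colex_subadd :: "nat \<Rightarrow> bool" where
  "colex_subadd n \<longleftrightarrow> (\<forall>k s t. s + t \<le> Suc n choose k \<longrightarrow>
     colex_count n k (s + t) \<le> colex_count n k s + colex_count n k t)"

text \<open>Subadditivity says that the initial segments are the densest windows; by complementation the
  final segments are the sparsest ones.\<close>

lemma colex_subadd_tail:
  assumes "colex_subadd n" and "u \<le> c" and "v \<le> c" and "u + v = c + z" and c: "c = Suc n choose k"
  shows "colex_count n k c + colex_count n k z \<le> colex_count n k u + colex_count n k v"
proof (cases "k \<le> Suc n")
  case True
  have C: "colex_count n k c + colex_count n (Suc n - k) (c - t) = (c - t) + colex_count n k t"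
    if "t \<le> c" for t
    using colex_count_complement[OF True, of "c - t"] that unfolding c by simp
  have "z \<le> c" using assms by simp
  have eq: "(c - u) + (c - v) = c - z" using assms by simp
  have "c = Suc n choose (Suc n - k)" using True c binomial_symmetric by blast
  then have "colex_count n (Suc n - k) (c - z) \<le>
      colex_count n (Suc n - k) (c - u) + colex_count n (Suc n - k) (c - v)"
    using assms(1) eq unfolding colex_subadd_def by (metis diff_le_self)
  then show ?thesis
    using C[of u] C[of v] C[of z] assms(2-4) \<open>z \<le> c\<close> eq by linarith
next
  case False
  then have "c = 0" using c by (simp del: binomial_Suc_Suc)
  then have "u = 0" "v = 0" "z = 0" using assms(2-4) by linarith+
  then show ?thesis using \<open>c = 0\<close> by simp
qed

text \<open>Among the first \<open>s\<close> sets of size \<open>k + 1\<close>, those without the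
  top element are treated by induction; the others share the top element, and deleting it leaves
  \<open>k\<close>-subsets. Subadditivity in degree \<open>k\<close> puts the two pieces
  together.\<close>

lemma colex_subadd_mono_degree:
  assumes "colex_subadd n" and "s \<le> Suc n choose k" and "s \<le> Suc p choose Suc k" and "p \<le> n"
  shows "colex_count n k s \<le> colex_count p (Suc k) s"
  using assms(2-)
proof (induction p arbitrary: s)
  case 0
  then have "s = 0 \<or> k = 0" by (cases k) auto
  then show ?case by auto
next
  case (Suc p)
  show ?case
  proof (cases "s \<le> Suc p choose Suc k")
    case True
    then show ?thesis using Suc by (simp add: colex_count_Suc del: binomial_Suc_Suc)
  next
    case False
    define c where "c = Suc p choose Suc k"
    from False obtain z where z: "s = c + z" "z \<le> Suc p choose k"
      using Suc.prems(2) by (metis add_le_cancel_left binomial_Suc_Suc c_def le_iff_add nat_le_linear add.commute)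
    have "colex_count n k (c + z) \<le> colex_count n k c + colex_count n k z"
      using assms(1) Suc.prems(1) z unfolding colex_subadd_def by blast
    also have "colex_count n k c \<le> colex_count p (Suc k) c"
      using Suc z by (intro Suc.IH) (auto simp: c_def simp del: binomial_Suc_Suc)
    also have "colex_count n k z = colex_count p k z"
      using Suc.prems z by (intro colex_count_stable) auto
    finally show ?thesis
      using colex_count_append[OF z(2)] z(1) by (simp add: c_def del: binomial_Suc_Suc)
  qed
qed

lemma colex_subadd_Suc:
  assumes sub: "colex_subadd n"
  shows "colex_subadd (Suc n)"
  unfolding colex_subadd_def
proof (intro allI impI)
  fix k s t
  assume le: "s + t \<le> Suc (Suc n) choose k"
  show "colex_count (Suc n) k (s + t) \<le> colex_count (Suc n) k s + colex_count (Suc n) k t"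
  proof (cases k)
    case (Suc k')
    define c where "c = Suc n choose Suc k'"
    define d where "d = Suc n choose k'"
    let ?D = "colex_count n (Suc k')" and ?D' = "colex_count n k'"
    have cd: "s + t \<le> c + d" using le Suc by (simp add: c_def d_def)
    have lo: "colex_count (Suc n) k x = ?D x" if "x \<le> c" for x
      using that Suc by (simp add: c_def colex_count_Suc del: binomial_Suc_Suc)
    have hi: "colex_count (Suc n) k (c + x) = ?D c + ?D' x" if "x \<le> d" for x
      using colex_count_append[of x n k'] that Suc by (simp add: c_def d_def del: binomial_Suc_Suc)
    have S: "?D (x + y) \<le> ?D x + ?D y" if "x + y \<le> c" for x y
      using sub that unfolding colex_subadd_def c_def by blast
    have S': "?D' (x + y) \<le> ?D' x + ?D' y" if "x + y \<le> d" for x y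
      using sub that unfolding colex_subadd_def d_def by blast
    have M: "?D' x \<le> ?D x" if "x \<le> c" "x \<le> d" for x
      using colex_subadd_mono_degree[OF sub, of x k' n] that by (simp add: c_def d_def)
    have mixed: "colex_count (Suc n) k (x + (c + y)) \<le> ?D x + (?D c + ?D' y)"
      if "x \<le> c" "x + y \<le> d" for x y
      using hi[of "x + y"] S'[of x y] M[of x] that by (simp add: algebra_simps)
    \<comment> \<open>The cases record which of \<open>s\<close>, \<open>t\<close>,
      \<open>s + t\<close> go beyond the \<open>c\<close> sets that avoid the top element. Beyond
      \<open>c\<close> the counting continues one degree lower, where \<open>M\<close> shows that
      counts are smaller; if only the sum crosses \<open>c\<close>, the tail inequality is used as
      well.\<close>
    consider "s + t \<le> c" | "s \<le> c" "t \<le> c" "c < s + t" | "s \<le> c" "c < t" | "c < s" "t \<le> c"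
      | "c < s" "c < t" by linarith
    then show ?thesis
    proof cases
      case 1
      then show ?thesis using S lo by simp
    next
      case 2
      then obtain z where z: "s + t = c + z" by (metis less_imp_le_nat nat_le_iff_add)
      then have "?D c + ?D z \<le> ?D s + ?D t"
        using 2 by (intro colex_subadd_tail[OF sub]) (auto simp: c_def)
      moreover have "z \<le> d" "z \<le> c" using z 2 cd by auto
      ultimately show ?thesis using z hi[of z] M[of z] lo 2 by simp
    next
      case 3
      then obtain t' where t': "t = c + t'" by (metis less_imp_le_nat nat_le_iff_add)
      then show ?thesis using mixed[of s t'] lo[of s] hi[of t'] cd 3 by simp
    next
      case 4
      then obtain s' where s': "s = c + s'" by (metis less_imp_le_nat nat_le_iff_add)
      then show ?thesis using mixed[of t s'] lo[of t] hi[of s'] cd 4 by (simp add: algebra_simps)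
    next
      case 5
      then obtain s' t' where st: "s = c + s'" "t = c + t'" by (metis less_imp_le_nat nat_le_iff_add)
      have eq: "s + t = c + (c + s' + t')" using st by simp
      have "c + s' + t' \<le> d" using st cd by simp
      then show ?thesis
        unfolding eq unfolding st
        using hi[of "c + s' + t'"] S'[of "c + s'" t'] S'[of c s'] M[of c] hi[of s'] hi[of t']
        by simp
    qed
  qed auto
qed

lemma colex_subadd: "colex_subadd n"
proof (induction n)
  case 0
  have "colex_count 0 k (s + t) \<le> colex_count 0 k s + colex_count 0 k t" for k s t
    by auto
  then show ?case by (simp add: colex_subadd_def)
qed (rule colex_subadd_Suc)

text \<open>By Macaulay's theorem, the least number of monomials of degree \<open>k - 1\<close> in a
  multicomplex with \<open>s\<close> monomials of degree \<open>k \<ge> 1\<close>. The value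
  \<open>k + s\<close> is just large enough a bound to guarantee \<open>s\<close> subsets of size
  \<open>k\<close>; larger ones give the same count.\<close>

definition min_shadow :: "nat \<Rightarrow> nat \<Rightarrow> nat" where
  "min_shadow k s = colex_count (k + s) k s"

lemma le_choose_add: "1 \<le> k \<Longrightarrow> s \<le> Suc (k + s) choose k"
proof (induction s)
  case (Suc s)
  have "0 < Suc (k + s) choose (k - 1)" by (intro zero_less_binomial) auto
  moreover have "Suc (k + Suc s) choose k = (Suc (k + s) choose (k - 1)) + (Suc (k + s) choose k)"
    using Suc.prems by (cases k) auto
  moreover have "s \<le> Suc (k + s) choose k" using Suc by simp
  ultimately show ?case by linarith
qed auto

lemma min_shadow_eq:
  assumes "s \<le> Suc n choose k"
  shows "min_shadow k s = colex_count n k s"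
proof (cases "k = 0")
  case False
  have "colex_count (max n (k + s)) k s = colex_count n k s"
    using assms by (intro colex_count_stable) auto
  moreover have "colex_count (max n (k + s)) k s = colex_count (k + s) k s"
    using le_choose_add[of k s] False by (intro colex_count_stable) auto
  ultimately show ?thesis by (simp add: min_shadow_def)
qed (auto simp: min_shadow_def)

lemma min_shadow_0 [simp]: "min_shadow 0 s = 0" "min_shadow k 0 = 0"
  by (auto simp: min_shadow_def)

lemma min_shadow_le: "min_shadow k s \<le> s"
  unfolding min_shadow_def by (rule colex_count_le)

lemma min_shadow_full: "min_shadow (Suc k) (Suc n choose Suc k) = n choose k"
  by (subst min_shadow_eq[of _ n]) (auto simp: colex_count_full simp del: binomial_Suc_Suc)

lemma min_shadow_append:
  assumes "z \<le> Suc n choose k"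
  shows "min_shadow (Suc k) ((Suc n choose Suc k) + z) = (n choose k) + min_shadow k z"
  using assms colex_count_append[OF assms] colex_count_full[of n k]
    min_shadow_eq[of "(Suc n choose Suc k) + z" "Suc n" "Suc k"] min_shadow_eq[OF assms]
  by simp

lemma obtain_choose_bound:
  obtains n where "s \<le> Suc n choose Suc k" "t \<le> Suc n choose Suc k"
proof
  show "s \<le> Suc (Suc k + (s + t)) choose Suc k" "t \<le> Suc (Suc k + (s + t)) choose Suc k"
    using le_choose_add[of "Suc k" "s + t"] by linarith+
qed

lemma min_shadow_mono:
  assumes "s \<le> t"
  shows "min_shadow k s \<le> min_shadow k t"
proof (cases k)
  case (Suc k')
  obtain n where "s \<le> Suc n choose Suc k'" "t \<le> Suc n choose Suc k'"
    by (rule obtain_choose_bound)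
  then show ?thesis
    using Suc colex_count_mono[OF assms] by (simp add: min_shadow_eq del: binomial_Suc_Suc)
qed auto

lemma min_shadow_subadd: "min_shadow k (s + t) \<le> min_shadow k s + min_shadow k t"
proof (cases k)
  case (Suc k')
  obtain n where n: "s + t \<le> Suc n choose Suc k'" "t \<le> Suc n choose Suc k'"
    by (rule obtain_choose_bound)
  then have "s \<le> Suc n choose Suc k'" by linarith
  moreover have "colex_count n (Suc k') (s + t) \<le> colex_count n (Suc k') s + colex_count n (Suc k') t"
    using n colex_subadd[of n] unfolding colex_subadd_def by blast
  ultimately show ?thesis
    using Suc n min_shadow_eq[of _ n "Suc k'"] by metis
qed auto

lemma min_shadow_tail:
  assumes "u \<le> c" and "v \<le> c" and "u + v = c + z" and c: "c = Suc n choose k"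
  shows "min_shadow k c + min_shadow k z \<le> min_shadow k u + min_shadow k v"
proof -
  have "z \<le> c" using assms by simp
  then show ?thesis
    using colex_subadd_tail[OF colex_subadd assms] assms min_shadow_eq[of _ n k]
    by (metis order_refl)
qed

lemma min_shadow_one [simp]: "min_shadow (Suc k) (Suc 0) = 1"
  using min_shadow_full[of k k] by simp

text \<open>In a multicomplex, let \<open>a\<close> and \<open>b\<close> count the monomials of degree \<open>k + 1\<close> that avoid,
  respectively contain, a fixed variable.\<close>

lemma min_shadow_split:
  "min_shadow (Suc k) (a + b) \<le> max b (min_shadow (Suc k) a + min_shadow k b)"
proof (induction k arbitrary: a b)
  case 0
  have le: "min_shadow (Suc 0) s \<le> 1" for s
  proof (cases "s = 0")
    case False
    then show ?thesis
      using min_shadow_full[of 0 "s - 1"] by simp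
  qed auto
  show ?case
    using le[of "a + b"] by (cases "b = 0") auto
next
  case (Suc k)
  show ?case
  proof (cases "b < min_shadow (Suc (Suc k)) (a + b)")
    case lt: True
    have "\<exists>n. (n choose Suc (Suc k)) \<le> a + b \<and> a + b < Suc n choose Suc (Suc k)"
    proof (rule ccontr)
      assume *: "\<not> ?thesis"
      have "(n choose Suc (Suc k)) \<le> a + b" for n
        by (induction n) (use * in force)+
      from this[of "Suc (Suc (Suc k) + Suc (a + b))"] le_choose_add[of "Suc (Suc k)" "Suc (a + b)"]
      show False by linarith
    qed
    then obtain n where n: "(n choose Suc (Suc k)) \<le> a + b" "a + b < Suc n choose Suc (Suc k)"
      by blast
    have "Suc k < n"
    proof (rule ccontr)
      assume "\<not> ?thesis"
      then have "Suc n choose Suc (Suc k) \<le> Suc (Suc k) choose Suc (Suc k)"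
        by (intro binomial_right_mono) auto
      then have "a + b = 0" using n(2) by simp
      then show False using lt by simp
    qed
    then obtain p where p: "n = Suc (Suc p)" by (cases n; cases "n - 1") auto
    \<comment> \<open>\<open>c\<close> is the leading binomial of the Macaulay representation of
      \<open>a + b\<close>, that is, the number of all monomials of this degree in suitably many
      variables. Pascal's rule splits it into \<open>c1\<close> monomials that avoid one variable
      and \<open>d1\<close> that contain it.\<close>
    define c where "c = n choose Suc (Suc k)"
    define c1 where "c1 = Suc p choose Suc (Suc k)"
    define d1 where "d1 = Suc p choose Suc k"
    define e1 where "e1 = Suc p choose k"
    have c: "c = c1 + d1" by (simp add: c_def c1_def d1_def p)
    obtain m where m: "a + b = c + m" using n(1) c_def by (metis le_iff_add)
    have mle: "m \<le> n choose Suc k" using n(2) m by (simp add: c_def)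
    have de: "n choose Suc k = d1 + e1" by (simp add: d1_def e1_def p)
    have sc: "min_shadow (Suc (Suc k)) (c + z) = d1 + min_shadow (Suc k) z"
      if "z \<le> n choose Suc k" for z
      using min_shadow_append[of z "Suc p" "Suc k"] that by (simp add: c_def d1_def p)
    have sc1: "min_shadow (Suc (Suc k)) (c1 + z) = (p choose Suc k) + min_shadow (Suc k) z"
      if "z \<le> d1" for z
      using min_shadow_append[of z p "Suc k"] that by (simp add: c1_def d1_def del: binomial_Suc_Suc)
    have sd1: "min_shadow (Suc k) (d1 + z) = (p choose k) + min_shadow k z" if "z \<le> e1" for z
      using min_shadow_append[of z p k] that by (simp add: e1_def d1_def del: binomial_Suc_Suc)
    have d1: "d1 = (p choose Suc k) + (p choose k)" by (simp add: d1_def)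
    have lt': "b < d1 + min_shadow (Suc k) m" using lt sc[OF mle] m by simp
    have "min_shadow (Suc (Suc k)) (a + b) \<le> min_shadow (Suc (Suc k)) a + min_shadow (Suc k) b"
    proof -
      \<comment> \<open>The cases compare the actual split of \<open>a + b\<close> with the extremal
        one. The bound \<open>lt'\<close> makes \<open>a < c1\<close> impossible, and for
        \<open>d1 \<le> b\<close> it excludes the first argument of the maximum in the induction
        hypothesis.\<close>
      consider "c \<le> a" | "c1 \<le> a" "a < c" "d1 \<le> b" | "c1 \<le> a" "a < c" "b < d1" | "a < c1"
        by linarith
      then show ?thesis
      proof cases
        case 1
        then obtain u where u: "a = c + u" by (metis le_iff_add)
        then have "u + b = m" using m by simp
        then show ?thesis
          unfolding m using u sc[of u] sc[OF mle] mle min_shadow_subadd[of "Suc k" u b] by simp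
      next
        case 2
        then obtain u w where uw: "a = c1 + u" "b = d1 + w" by (metis le_iff_add)
        then have "u \<le> d1" "u + w = m" using 2 c m by auto
        have w: "w < min_shadow (Suc k) m" using lt' uw by simp
        also have "\<dots> \<le> min_shadow (Suc k) (n choose Suc k)" by (rule min_shadow_mono[OF mle])
        also have "\<dots> = e1" using min_shadow_full[of k "Suc p"] by (simp add: e1_def p)
        finally have "w \<le> e1" by simp
        have "min_shadow (Suc k) m \<le> min_shadow (Suc k) u + min_shadow k w"
          using Suc.IH[of u w] w \<open>u + w = m\<close> by simp
        then show ?thesis
          using sc[OF mle] sc1[OF \<open>u \<le> d1\<close>] sd1[OF \<open>w \<le> e1\<close>] d1 m uw by simp
      next
        case 3
        then obtain u where u: "a = c1 + u" by (metis le_iff_add)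
        then have "u \<le> d1" "u + b = d1 + m" using 3 c m by auto
        then have "min_shadow (Suc k) d1 + min_shadow (Suc k) m \<le> min_shadow (Suc k) u + min_shadow (Suc k) b"
          using 3 by (intro min_shadow_tail[where n = p]) (auto simp: d1_def)
        moreover have "min_shadow (Suc k) d1 = p choose k"
          unfolding d1_def by (rule min_shadow_full)
        ultimately show ?thesis
          using sc[OF mle] sc1[OF \<open>u \<le> d1\<close>] d1 m u by simp
      next
        case 4
        then show ?thesis using lt' min_shadow_le[of "Suc k" m] c m by linarith
      qed
    qed
    then show ?thesis by simp
  qed simp
qed

text \<open>Exceeding the pseudo-power by one forces a shadow of \<open>j + 1\<close>; by
  monotonicity, a shadow of at most \<open>j\<close> therefore bounds the count by the pseudo-power.
  The first conjunct lets the lower terms be appended behind the next leading binomial.\<close>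

lemma min_shadow_macaulay_rep:
  assumes "macaulay_rep i j l a"
  shows "(\<Sum>k=l..i. (a k + 1) choose (k + 1)) < Suc (Suc (a i)) choose Suc i \<and>
    min_shadow (Suc i) (Suc (\<Sum>k=l..i. (a k + 1) choose (k + 1))) = Suc j"
  using assms
proof (induction i arbitrary: j)
  case 0
  then show ?case by (auto simp: macaulay_rep_def)
next
  case (Suc i)
  let ?S = "\<lambda>i. \<Sum>k=l..i. (a k + 1) choose (k + 1)"
  from Suc.prems show ?case
  proof (cases rule: macaulay_rep_cases)
    case 1
    have "0 < Suc (a (Suc i)) choose Suc i" using 1 by (intro zero_less_binomial) auto
    then have pos: "1 \<le> Suc (a (Suc i)) choose Suc i" by linarith
    have "min_shadow (Suc (Suc i)) ((Suc (a (Suc i)) choose Suc (Suc i)) + 1) = Suc j"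
      using min_shadow_append[OF pos] min_shadow_one[of i] 1 by (simp del: binomial_Suc_Suc)
    then show ?thesis using 1 pos by simp
  next
    case (2 i' j')
    then have IH: "?S i < Suc (Suc (a i)) choose Suc i" "min_shadow (Suc i) (Suc (?S i)) = Suc j'"
      using Suc.IH[of j'] by auto
    have "Suc (Suc (a i)) choose Suc i \<le> Suc (a (Suc i)) choose Suc i"
      using 2 by (intro binomial_right_mono) auto
    with IH have le: "Suc (?S i) \<le> Suc (a (Suc i)) choose Suc i" by simp
    have S: "?S (Suc i) = (Suc (a (Suc i)) choose Suc (Suc i)) + ?S i"
      using 2 by simp
    have "min_shadow (Suc (Suc i)) ((Suc (a (Suc i)) choose Suc (Suc i)) + Suc (?S i)) = Suc j"
      using min_shadow_append[OF le] IH 2 by simp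
    then show ?thesis using le unfolding S by simp
  qed
qed

lemma le_pseudo_power:
  assumes "1 \<le> i" and le: "min_shadow (Suc i) f' \<le> f"
  shows "f' \<le> pseudo_power f i"
proof (cases "f = 0")
  case True
  have "f' = 0"
  proof (rule ccontr)
    assume "f' \<noteq> 0"
    then have "min_shadow (Suc i) (Suc 0) \<le> min_shadow (Suc i) f'"
      by (intro min_shadow_mono) auto
    then show False using True le by simp
  qed
  then show ?thesis by simp
next
  case False
  then obtain l a where rep: "macaulay_rep i f l a"
    using macaulay_rep_exists[of i f] assms(1) by auto
  have "\<not> Suc (pseudo_power f i) \<le> f'"
    using min_shadow_mono[of "Suc (pseudo_power f i)" f' "Suc i"] le
      min_shadow_macaulay_rep[OF rep] unfolding pseudo_power_eq[OF rep] by auto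
  then show ?thesis by simp
qed

section \<open>Dimensions of spaces of functions\<close>

context vector_space
begin

text \<open>The full space of functions may be infinite dimensional, so finiteness is carried along
  by a finite set \<open>C\<close> whose span contains the subspace.\<close>

lemma dim_mono_finite:
  assumes "V \<subseteq> W" and "W \<subseteq> span C" and "finite C"
  shows "dim V \<le> dim W"
proof -
  obtain A where A: "A \<subseteq> V" "independent A" "V \<subseteq> span A" "card A = dim V"
    using basis_exists by blast
  obtain B where B: "B \<subseteq> W" "independent B" "W \<subseteq> span B" "card B = dim W"
    using basis_exists by blast
  have "finite B"
    using independent_span_bound[OF assms(3) B(2)] B(1) assms(2) by auto
  then have "card A \<le> card B"
    using independent_span_bound[OF _ A(2), of B] A(1) B(3) assms(1) by auto
  then show ?thesis using A B by simp
qed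

lemma one_le_dim:
  assumes "x \<in> V" and "x \<noteq> 0" and "V \<subseteq> span C" and "finite C"
  shows "1 \<le> dim V"
proof -
  have "dim {x} = 1"
    using assms(2) dim_eq_card_independent[of "{x}"] by simp
  then show ?thesis
    using dim_mono_finite[of "{x}" V C] assms by simp
qed

lemma span_Int_independent:
  assumes "independent (A \<union> B)" and "A \<inter> B = {}" and "x \<in> span A" and "x \<in> span B"
  shows "x = 0"
proof -
  have "representation (A \<union> B) x b = 0" for b
    using representation_extend[OF assms(1,3)] representation_extend[OF assms(1,4)]
      representation_ne_zero[of A x b] representation_ne_zero[of B x b] assms(2) by auto
  moreover have "x \<in> span (A \<union> B)" using assms(3) span_mono[of A "A \<union> B"] by auto
  ultimately show ?thesis
    using sum_nonzero_representation_eq[OF assms(1), of x] by simp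
qed

text \<open>A basis of the kernel is extended to a basis of \<open>W\<close>; \<open>f\<close> is
  injective on the span of the added vectors, whose images form a basis of the image.\<close>

lemma dim_kernel_image:
  assumes lin: "Vector_Spaces.linear scale scale f" and W: "subspace W" "W \<subseteq> span C" "finite C"
  shows "dim W = dim {x \<in> W. f x = 0} + dim (f ` W)"
proof -
  interpret f: vector_space_pair scale scale ..
  let ?N = "{x \<in> W. f x = 0}"
  obtain A where A: "A \<subseteq> ?N" "independent A" "?N \<subseteq> span A" "card A = dim ?N"
    using basis_exists by blast
  have "A \<subseteq> W" using A(1) by auto
  from maximal_independent_subset_extend[OF this A(2)]
  obtain B where B: "A \<subseteq> B" "B \<subseteq> W" "independent B" "W \<subseteq> span B"
    by blast
  have "finite B"
    using independent_span_bound[OF W(3) B(3)] B(2) W(2) by auto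
  have "span (B - A) \<subseteq> W" using B(2) W(1) by (intro span_minimal) auto
  have inj: "inj_on f (span (B - A))"
  proof (subst f.linear_inj_on_iff_eq_0[OF lin subspace_span], intro ballI impI)
    fix x assume x: "x \<in> span (B - A)" "f x = 0"
    then have "x \<in> span A" using \<open>span (B - A) \<subseteq> W\<close> A(3) by auto
    moreover have "A \<union> (B - A) = B" using B(1) by auto
    ultimately show "x = 0"
      using span_Int_independent[of A "B - A" x] B(3) x(1) by auto
  qed
  have "independent (f ` (B - A))"
    using f.linear_independent_injective_image[OF lin _ inj] independent_mono[OF B(3)] by auto
  moreover have "f ` W \<subseteq> span (f ` (B - A))"
  proof
    fix y assume "y \<in> f ` W"
    then obtain x where x: "x \<in> W" "y = f x" by auto
    have "f ` W \<subseteq> span (f ` B)"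
      using f.linear_span_image[OF lin, of B] B(4) by auto
    moreover have "f ` B \<subseteq> insert 0 (f ` (B - A))" using A(1) by auto
    ultimately have "y \<in> span (insert 0 (f ` (B - A)))"
      using x span_mono by blast
    then show "y \<in> span (f ` (B - A))" by simp
  qed
  moreover have "f ` (B - A) \<subseteq> f ` W" using B(2) by auto
  ultimately have "dim (f ` W) = card (f ` (B - A))"
    using basis_card_eq_dim by metis
  also have "\<dots> = card (B - A)"
    using inj_on_subset[OF inj span_superset] by (rule card_image)
  also have "\<dots> = card B - card A"
    using \<open>finite B\<close> B(1) by (meson card_Diff_subset finite_subset)
  finally show ?thesis
    using A(4) basis_card_eq_dim[OF B(2,4,3)] card_mono[OF \<open>finite B\<close> B(1)] by simp
qed

end

section \<open>Spaces of real functions with finite support\<close>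

definition fun_scale :: "real \<Rightarrow> ('b \<Rightarrow> real) \<Rightarrow> 'b \<Rightarrow> real" where
  "fun_scale c f = (\<lambda>x. c * f x)"

lemma fun_scale_apply: "fun_scale c f x = c * f x"
  by (simp add: fun_scale_def)

interpretation fun_space: vector_space fun_scale
  by standard (auto simp: fun_scale_def fun_eq_iff algebra_simps)

lemma sum_fun_apply: "(\<Sum>i\<in>A. f i) x = (\<Sum>i\<in>A. f i x)"
  by (induction A rule: infinite_finite_induct) auto

lemma linear_fun_scaleI:
  assumes "\<And>f g. D (f + g) = D f + D g" and "\<And>c f. D (fun_scale c f) = fun_scale c (D f)"
  shows "Vector_Spaces.linear fun_scale fun_scale D"
  using assms by unfold_locales auto

lemma subspace_fun_scaleI:
  assumes "0 \<in> W" and "\<And>f g. f \<in> W \<Longrightarrow> g \<in> W \<Longrightarrow> f + g \<in> W"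
    and "\<And>c f. f \<in> W \<Longrightarrow> fun_scale c f \<in> W"
  shows "fun_space.subspace W"
  using assms by (auto simp: fun_space.subspace_def)

definition supported :: "'b set \<Rightarrow> ('b \<Rightarrow> real) set" where
  "supported B = {f. \<forall>x. f x \<noteq> 0 \<longrightarrow> x \<in> B}"

lemma subspace_supported: "fun_space.subspace (supported B)"
  by (rule subspace_fun_scaleI) (force simp: supported_def fun_scale_apply)+

lemma supported_basis:
  assumes "finite B"
  defines "e \<equiv> (\<lambda>b x. if x = b then 1 else (0::real))"
  shows "fun_space.independent (e ` B)" and "fun_space.span (e ` B) = supported B"
    and "card (e ` B) = card B"
proof -
  have inj: "inj_on e B"
    by (rule inj_onI) (metis e_def zero_neq_one)
  then show "card (e ` B) = card B" by (rule card_image)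
  show "fun_space.independent (e ` B)"
  proof (rule fun_space.independent_if_scalars_zero)
    fix c y assume *: "(\<Sum>y\<in>e ` B. fun_scale (c y) y) = 0" and "y \<in> e ` B"
    then obtain b where b: "b \<in> B" "y = e b" by auto
    have "(\<Sum>y\<in>e ` B. fun_scale (c y) y) b = (\<Sum>x\<in>B. c (e x) * e x b)"
      by (simp add: sum_fun_apply sum.reindex[OF inj] fun_scale_apply)
    also have "\<dots> = (\<Sum>x\<in>B. if x = b then c (e b) else 0)"
      by (intro sum.cong) (auto simp: e_def)
    also have "\<dots> = c y" using b assms(1) by simp
    finally show "c y = 0" using * by simp
  qed (use assms in auto)
  have "e ` B \<subseteq> supported B" by (auto simp: e_def supported_def split: if_splits)
  then have "fun_space.span (e ` B) \<subseteq> supported B"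
    by (rule fun_space.span_minimal) (rule subspace_supported)
  moreover have "f \<in> fun_space.span (e ` B)" if "f \<in> supported B" for f
  proof -
    have "f = (\<Sum>b\<in>B. fun_scale (f b) (e b))"
    proof
      fix x
      have "(\<Sum>b\<in>B. f b * e b x) = (\<Sum>b\<in>B. if b = x then f x else 0)"
        by (intro sum.cong) (auto simp: e_def)
      also have "\<dots> = f x" using that assms(1) by (auto simp: supported_def)
      finally show "f x = (\<Sum>b\<in>B. fun_scale (f b) (e b)) x" by (simp add: sum_fun_apply fun_scale_apply)
    qed
    moreover have "(\<Sum>b\<in>B. fun_scale (f b) (e b)) \<in> fun_space.span (e ` B)"
      by (intro fun_space.span_sum fun_space.span_scale fun_space.span_base) auto
    ultimately show ?thesis by simp
  qed
  ultimately show "fun_space.span (e ` B) = supported B" by auto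
qed

lemma dim_supported: "finite B \<Longrightarrow> fun_space.dim (supported B) = card B"
  using supported_basis[of B] fun_space.dim_span_eq_card_independent by metis

lemma supported_finite_span:
  assumes "finite B" and "W \<subseteq> supported B"
  shows "\<exists>C. finite C \<and> W \<subseteq> fun_space.span C"
  using supported_basis(2)[OF assms(1)] assms by (metis finite_imageI)

lemma fun_dim_mono:
  assumes "finite B" and "W \<subseteq> supported B" and "V \<subseteq> W"
  shows "fun_space.dim V \<le> fun_space.dim W"
  using fun_space.dim_mono_finite[OF assms(3)] supported_finite_span[OF assms(1,2)] by blast

lemma fun_dim_kernel_image:
  fixes f :: "('b \<Rightarrow> real) \<Rightarrow> ('b \<Rightarrow> real)"
  assumes "finite B" and "W \<subseteq> supported B" and "fun_space.subspace W"
    and "Vector_Spaces.linear fun_scale fun_scale f"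
  shows "fun_space.dim W = fun_space.dim {x \<in> W. f x = 0} + fun_space.dim (f ` W)"
  using fun_space.dim_kernel_image[OF assms(4,3)] supported_finite_span[OF assms(1,2)] by blast

text \<open>Dually to a standard graded algebra, a graded family of spaces on which the variables act by
  lowering operators. A joint kernel that vanishes in positive degree corresponds to generation in
  degree \<open>0\<close>.\<close>

definition inverse_system :: 
  "'v set \<Rightarrow> ('v \<Rightarrow> ('b \<Rightarrow> real) \<Rightarrow> 'b \<Rightarrow> real) \<Rightarrow> (nat \<Rightarrow> ('b \<Rightarrow> real) set) \<Rightarrow> bool" where
  "inverse_system E D W \<longleftrightarrow>
     (\<forall>v\<in>E. Vector_Spaces.linear fun_scale fun_scale (D v)) \<and>
     (\<forall>u\<in>E. \<forall>v\<in>E. \<forall>x. D u (D v x) = D v (D u x)) \<and>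
     (\<forall>d. fun_space.subspace (W d) \<and> (\<exists>C. finite C \<and> W d \<subseteq> supported C)) \<and>
     (\<forall>v\<in>E. \<forall>d. \<forall>x\<in>W (Suc d). D v x \<in> W d) \<and>
     (\<forall>d. \<forall>x\<in>W (Suc d). (\<forall>v\<in>E. D v x = 0) \<longrightarrow> x = 0)"

text \<open>Kernel \<open>N\<close> and image \<open>B\<close> of one operator \<open>D v\<close>
  are dual to setting the variable \<open>v\<close> to zero and to dividing by it. \<open>N\<close>
  is an inverse system with one variable less, while \<open>B\<close> keeps all variables but is
  used one degree lower; hence the double induction. In \<open>min_shadow_split\<close> the first
  argument of the maximum is covered by the inclusion of \<open>B\<close> in \<open>W\<close>, the
  second by the two induction hypotheses.\<close>

lemma macaulay_growth:
  assumes "finite E" and "inverse_system E D W"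
  shows "min_shadow (Suc d) (fun_space.dim (W (Suc d))) \<le> fun_space.dim (W d)"
  using assms
proof (induction E arbitrary: W d rule: finite_induct)
  case empty
  then have "W (Suc d) \<subseteq> {0}" by (auto simp: inverse_system_def)
  then have "fun_space.dim (W (Suc d)) = 0"
    using fun_space.dim_le_card[of "W (Suc d)" "{}"] by simp
  then show ?case by simp
next
  case (insert v E)
  show ?case
    using insert.prems
  proof (induction d arbitrary: W)
    case 0
    obtain C where C: "finite C" "W 0 \<subseteq> supported C" using 0 unfolding inverse_system_def by blast
    show ?case
    proof (cases "W (Suc 0) \<subseteq> {0}")
      case True
      then have "fun_space.dim (W (Suc 0)) = 0" using fun_space.dim_le_card[of "W (Suc 0)" "{}"] by simp
      then show ?thesis by simp
    next
      case False
      then obtain x where "x \<in> W (Suc 0)" "x \<noteq> 0" by auto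
      then obtain u where "D u x \<noteq> 0" "D u x \<in> W 0"
        using 0 unfolding inverse_system_def by blast
      then have "1 \<le> fun_space.dim (W 0)" using fun_space.one_le_dim supported_finite_span[OF C] by blast
      moreover have "min_shadow (Suc 0) s \<le> 1" for s
        using min_shadow_full[of 0 "s - 1"] by (cases s) auto
      ultimately show ?thesis using order.trans by blast
    qed
  next
    case (Suc d)
    define N where "N = (\<lambda>d. {x \<in> W d. D v x = 0})"
    define B where "B = (\<lambda>d. D v ` W (Suc d))"
    have lin: "Vector_Spaces.linear fun_scale fun_scale (D u)" if "u \<in> insert v E" for u
      using Suc.prems that by (auto simp: inverse_system_def)
    have com: "D u (D w x) = D w (D u x)" if "u \<in> insert v E" "w \<in> insert v E" for u w x
      using Suc.prems that unfolding inverse_system_def by blast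
    have sub: "fun_space.subspace (W e)" for e
      using Suc.prems by (auto simp: inverse_system_def)
    have fin: "\<exists>C. finite C \<and> W e \<subseteq> supported C" for e
      using Suc.prems by (auto simp: inverse_system_def)
    have low: "D u x \<in> W e" if "u \<in> insert v E" "x \<in> W (Suc e)" for u e x
      using Suc.prems that unfolding inverse_system_def by blast
    have ker: "x = 0" if "x \<in> W (Suc e)" "\<And>u. u \<in> insert v E \<Longrightarrow> D u x = 0" for x e
      using Suc.prems that unfolding inverse_system_def by blast
    have zero: "D u 0 = 0" if "u \<in> insert v E" for u
      using module_hom.zero[of fun_scale fun_scale "D u"] lin[OF that]
      by (simp add: module_hom_iff_linear)
    have subN: "fun_space.subspace (N e)" for e
    proof -
      have "N e = W e \<inter> {x. D v x = 0}" by (auto simp: N_def)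
      then show ?thesis
        using fun_space.subspace_inter[OF sub] module_hom.subspace_kernel[of fun_scale fun_scale "D v"] lin[of v]
        by (simp add: module_hom_iff_linear)
    qed
    have subB: "fun_space.subspace (B e)" for e
      unfolding B_def using module_hom.subspace_image[of fun_scale fun_scale "D v"] lin[of v] sub
      by (simp add: module_hom_iff_linear)
    have BW: "B e \<subseteq> W e" for e using low by (auto simp: B_def)
    have "inverse_system E D N"
      unfolding inverse_system_def
    proof (intro conjI ballI allI impI)
      show "\<exists>C. finite C \<and> N e \<subseteq> supported C" for e using fin[of e] by (auto simp: N_def)
      show "D u x \<in> N e" if "u \<in> E" "x \<in> N (Suc e)" for u e x
        using that low com[of v u x] zero[of u] by (auto simp: N_def)
      show "x = 0" if "x \<in> N (Suc e)" "\<forall>u\<in>E. D u x = 0" for x e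
        using that ker by (auto simp: N_def)
    qed (use lin com subN in auto)
    then have IH1: "min_shadow (Suc (Suc d)) (fun_space.dim (N (Suc (Suc d)))) \<le> fun_space.dim (N (Suc d))"
      by (rule insert.IH)
    have "inverse_system (insert v E) D B"
      unfolding inverse_system_def
    proof (intro conjI ballI allI impI)
      show "\<exists>C. finite C \<and> B e \<subseteq> supported C" for e using fin[of e] BW[of e] by blast
      show "D u x \<in> B e" if "u \<in> insert v E" "x \<in> B (Suc e)" for u e x
        using that low com[of u v] by (auto simp: B_def)
      show "x = 0" if "x \<in> B (Suc e)" "\<forall>u\<in>insert v E. D u x = 0" for x e
        using that ker BW by blast
    qed (use lin com subB in auto)
    then have IH2: "min_shadow (Suc d) (fun_space.dim (B (Suc d))) \<le> fun_space.dim (B d)"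
      by (rule Suc.IH)
    have dim: "fun_space.dim (W (Suc e)) = fun_space.dim (N (Suc e)) + fun_space.dim (B e)" for e
      using fun_dim_kernel_image[OF _ _ sub lin[of v]] fin[of "Suc e"] by (auto simp: N_def B_def)
    have "fun_space.dim (B (Suc d)) \<le> fun_space.dim (W (Suc d))"
      using fun_dim_mono[OF _ _ BW] fin by blast
    then show ?case
      using min_shadow_split[of "Suc d" "fun_space.dim (N (Suc (Suc d)))" "fun_space.dim (B (Suc d))"] IH1 IH2
      unfolding dim[of d] dim[of "Suc d"] by linarith
  qed
qed

text \<open>A certificate for a dimension bound. Unlike the dimension, it comes with coordinates
  that can be kept fixed while the linear forms vary, and it can be glued along a splitting of the
  complex.\<close>

definition determines :: "'b set \<Rightarrow> ('b \<Rightarrow> real) set \<Rightarrow> bool" where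
  "determines K W \<longleftrightarrow> (\<forall>f\<in>W. (\<forall>x\<in>K. f x = 0) \<longrightarrow> f = 0)"

lemma determinesD: "determines K W \<Longrightarrow> f \<in> W \<Longrightarrow> (\<And>x. x \<in> K \<Longrightarrow> f x = 0) \<Longrightarrow> f = 0"
  by (auto simp: determines_def)

lemma dim_le_determines:
  assumes "finite B" and "W \<subseteq> supported B" and "fun_space.subspace W"
    and "finite K" and "determines K W"
  shows "fun_space.dim W \<le> card K"
proof -
  define R where "R = (\<lambda>(f::'a \<Rightarrow> real) x. if x \<in> K then f x else 0)"
  have "Vector_Spaces.linear fun_scale fun_scale R"
    by (rule linear_fun_scaleI) (auto simp: R_def fun_eq_iff fun_scale_apply)
  then have "fun_space.dim W = fun_space.dim {f \<in> W. R f = 0} + fun_space.dim (R ` W)"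
    by (rule fun_dim_kernel_image[OF assms(1-3)])
  also have "{f \<in> W. R f = 0} \<subseteq> {0}"
  proof
    fix f assume "f \<in> {f \<in> W. R f = 0}"
    then have "f \<in> W" "\<forall>x. R f x = 0" by (auto simp: fun_eq_iff)
    then have "f = 0" using assms(5) by (intro determinesD) (auto simp: R_def split: if_splits)
    then show "f \<in> {0}" by simp
  qed
  then have "fun_space.dim {f \<in> W. R f = 0} = 0"
    using fun_space.dim_le_card[of "{f \<in> W. R f = 0}" "{}"] by simp
  also have "fun_space.dim (R ` W) \<le> fun_space.dim (supported K)"
    by (rule fun_dim_mono[OF assms(4) order_refl]) (auto simp: R_def supported_def split: if_splits)
  finally show ?thesis using dim_supported[OF assms(4)] by simp
qed

text \<open>A coordinate at which some element of \<open>W\<close> does not vanish is added to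
  \<open>K\<close>; the subspace vanishing there has smaller dimension, so at most
  \<open>dim W\<close> coordinates are collected.\<close>

lemma ex_determines:
  assumes "finite B" and "W \<subseteq> supported B" and "fun_space.subspace W"
  shows "\<exists>K. finite K \<and> card K \<le> fun_space.dim W \<and> determines K W"
  using assms(2-)
proof (induction "fun_space.dim W" arbitrary: W rule: less_induct)
  case less
  show ?case
  proof (cases "W \<subseteq> {0}")
    case True
    then show ?thesis by (intro exI[of _ "{}"]) (auto simp: determines_def)
  next
    case False
    then obtain f where "f \<in> W" "f \<noteq> 0" by auto
    then obtain x where f: "f \<in> W" "f x \<noteq> 0" by (auto simp: fun_eq_iff)
    define R where "R = (\<lambda>(f::'a \<Rightarrow> real) y. if y = x then f x else 0)"
    define W' where "W' = {f \<in> W. R f = 0}"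
    have R0: "R g = 0 \<longleftrightarrow> g x = 0" for g by (auto simp: R_def fun_eq_iff fun_scale_apply)
    have lin: "Vector_Spaces.linear fun_scale fun_scale R"
      by (rule linear_fun_scaleI) (auto simp: R_def fun_eq_iff fun_scale_apply)
    then have "fun_space.dim W = fun_space.dim W' + fun_space.dim (R ` W)"
      unfolding W'_def by (rule fun_dim_kernel_image[OF assms(1) less.prems])
    moreover have "1 \<le> fun_space.dim (R ` W)"
    proof -
      have "R ` W \<subseteq> supported {x}" by (auto simp: R_def supported_def split: if_splits)
      then obtain C where "finite C" "R ` W \<subseteq> fun_space.span C"
        using supported_finite_span[of "{x}" "R ` W"] by auto
      then show ?thesis using fun_space.one_le_dim[of "R f" "R ` W" C] f R0[of f] by blast
    qed
    ultimately have lt: "fun_space.dim W' < fun_space.dim W" by simp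
    have "fun_space.subspace W'"
      using less.prems(2) unfolding W'_def R0
      by (intro subspace_fun_scaleI) (auto simp: fun_space.subspace_def fun_scale_apply)
    then obtain K where K: "finite K" "card K \<le> fun_space.dim W'" "determines K W'"
      using less.hyps[OF lt] less.prems by (auto simp: W'_def)
    have "determines (insert x K) W"
      using K(3) by (auto simp: determines_def W'_def R0)
    moreover have "card (insert x K) \<le> fun_space.dim W"
      using K lt by (auto simp: card_insert_if)
    ultimately show ?thesis using K(1) by blast
  qed
qed

text \<open>For \<open>t \<noteq> 0\<close>, a vector \<open>f\<close> with \<open>A f + t B f = 0\<close> behaves like an eigenvector for the
  eigenvalue \<open>- 1 / t\<close>: such vectors for distinct \<open>t\<close> are independent.\<close>

lemma pencil_independent:
  fixes A B :: "('b \<Rightarrow> real) \<Rightarrow> ('c \<Rightarrow> real)"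
  assumes "Vector_Spaces.linear fun_scale fun_scale A" and "Vector_Spaces.linear fun_scale fun_scale B"
    and V: "fun_space.subspace V" and inj: "\<And>f. f \<in> V \<Longrightarrow> A f = 0 \<Longrightarrow> f = 0"
    and "finite T" and "\<And>t. t \<in> T \<Longrightarrow> f t \<in> V \<and> f t \<noteq> 0 \<and> A (f t) + fun_scale t (B (f t)) = 0"
    and "(\<Sum>t\<in>T. fun_scale (c t) (f t)) = 0" and "t \<in> T"
  shows "c t = 0"
  using assms(5-)
proof (induction T arbitrary: c t rule: finite_induct)
  case (insert s T)
  interpret A: Vector_Spaces.linear fun_scale fun_scale A by (rule assms(1))
  interpret B: Vector_Spaces.linear fun_scale fun_scale B by (rule assms(2))
  have f: "f t \<in> V" "f t \<noteq> 0" "A (f t) + fun_scale t (B (f t)) = 0" if "t \<in> insert s T" for t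
    using insert.prems(1)[OF that] by blast+
  have nz: "t \<noteq> 0" if "t \<in> insert s T" for t
    using f[OF that] inj[of "f t"] by (auto simp: fun_eq_iff fun_scale_apply)
  have Bf: "B (f t) = fun_scale (- 1 / t) (A (f t))" if "t \<in> insert s T" for t
    using f(3)[OF that] nz[OF that] by (auto simp: fun_eq_iff fun_scale_apply field_simps add_eq_0_iff)
  have sum0: "fun_scale (c s) (f s) + (\<Sum>t\<in>T. fun_scale (c t) (f t)) = 0"
    using insert.prems(2) unfolding sum.insert[OF insert.hyps] .
  have "A (fun_scale (c s) (f s) + (\<Sum>t\<in>T. fun_scale (c t) (f t))) = 0"
    unfolding sum0 by (rule A.zero)
  then have 1: "fun_scale (c s) (A (f s)) + (\<Sum>t\<in>T. fun_scale (c t) (A (f t))) = 0"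
    by (simp add: A.add A.scale A.sum)
  have "B (fun_scale (c s) (f s) + (\<Sum>t\<in>T. fun_scale (c t) (f t))) = 0"
    unfolding sum0 by (rule B.zero)
  then have 2: "fun_scale (c s) (B (f s)) + (\<Sum>t\<in>T. fun_scale (c t) (B (f t))) = 0"
    by (simp add: B.add B.scale B.sum)
  \<comment> \<open>Applying \<open>A\<close>, and \<open>s\<close> times \<open>B\<close>, to the
    given relation and adding the results cancels the term of \<open>s\<close> and multiplies that
    of \<open>t\<close> by \<open>1 - s / t\<close>, which is nonzero for
    \<open>t \<noteq> s\<close>.\<close>
  define c' where "c' = (\<lambda>t. c t * (1 - s / t))"
  have "A (\<Sum>t\<in>T. fun_scale (c' t) (f t)) = 0"
  proof
    fix x
    have "c s * A (f s) x + (\<Sum>t\<in>T. c t * A (f t) x) = 0"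
      using fun_cong[OF 1, of x] by (simp add: sum_fun_apply fun_scale_apply)
    moreover have "- (c s * A (f s) x / s) + (\<Sum>t\<in>T. - (c t * A (f t) x / t)) = 0"
      using fun_cong[OF 2, of x] by (simp add: sum_fun_apply Bf fun_scale_apply)
    then have "s * (- (c s * A (f s) x / s) + (\<Sum>t\<in>T. - (c t * A (f t) x / t))) = 0"
      by simp
    then have "- (c s * A (f s) x) + (\<Sum>t\<in>T. - (s / t * (c t * A (f t) x))) = 0"
      using nz[of s] by (simp add: distrib_left sum_distrib_left algebra_simps)
    ultimately have "(\<Sum>t\<in>T. c t * A (f t) x) + (\<Sum>t\<in>T. - (s / t * (c t * A (f t) x))) = 0"
      by linarith
    moreover have "A (\<Sum>t\<in>T. fun_scale (c' t) (f t)) x = (\<Sum>t\<in>T. c' t * A (f t) x)"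
      by (simp add: A.sum A.scale sum_fun_apply fun_scale_apply)
    moreover have "(\<Sum>t\<in>T. c' t * A (f t) x) =
        (\<Sum>t\<in>T. c t * A (f t) x) + (\<Sum>t\<in>T. - (s / t * (c t * A (f t) x)))"
      by (simp add: c'_def algebra_simps flip: sum.distrib)
    ultimately show "A (\<Sum>t\<in>T. fun_scale (c' t) (f t)) x = 0 x" by simp
  qed
  moreover have "(\<Sum>t\<in>T. fun_scale (c' t) (f t)) \<in> V"
    using V f by (intro fun_space.subspace_sum fun_space.subspace_scale) auto
  ultimately have "(\<Sum>t\<in>T. fun_scale (c' t) (f t)) = 0" using inj by blast
  then have c': "c' t = 0" if "t \<in> T" for t using insert.IH[of c' t] insert.prems that by auto
  have T: "c t = 0" if "t \<in> T" for t
    using c'[OF that] nz[of t] that insert.hyps by (auto simp: c'_def)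
  have "(\<Sum>t\<in>T. fun_scale (c t) (f t)) = 0"
    by (rule sum.neutral) (use T in auto)
  then have "fun_scale (c s) (f s) = 0" using sum0 by (metis add.right_neutral)
  then have "c s = 0" using f(2)[of s] by simp
  then show ?case using T insert.prems(3) by auto
qed auto

text \<open>Kernel vectors for more than \<open>card X\<close> parameters would be too many
  independent vectors in \<open>supported X\<close>. This takes the place of a nonvanishing minor of
  \<open>A + t B\<close>, a polynomial in \<open>t\<close> with finitely many roots.\<close>

lemma finite_pencil_kernel:
  fixes A B :: "('b \<Rightarrow> real) \<Rightarrow> ('c \<Rightarrow> real)"
  assumes A: "Vector_Spaces.linear fun_scale fun_scale A" and B: "Vector_Spaces.linear fun_scale fun_scale B"
    and V: "fun_space.subspace V" "V \<subseteq> supported X" "finite X"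
    and inj: "\<And>f. f \<in> V \<Longrightarrow> A f = 0 \<Longrightarrow> f = 0"
  shows "finite {t. \<exists>f\<in>V. f \<noteq> 0 \<and> A f + fun_scale t (B f) = 0}"
proof (rule ccontr)
  assume "infinite {t. \<exists>f\<in>V. f \<noteq> 0 \<and> A f + fun_scale t (B f) = 0}"
  then obtain T where T: "T \<subseteq> {t. \<exists>f\<in>V. f \<noteq> 0 \<and> A f + fun_scale t (B f) = 0}"
    "finite T" "card T = Suc (card X)"
    using infinite_arbitrarily_large by blast
  then have "\<forall>t\<in>T. \<exists>f. f \<in> V \<and> f \<noteq> 0 \<and> A f + fun_scale t (B f) = 0" by blast
  from bchoice[OF this] obtain f
    where f: "\<And>t. t \<in> T \<Longrightarrow> f t \<in> V \<and> f t \<noteq> 0 \<and> A (f t) + fun_scale t (B (f t)) = 0"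
    by blast
  have indep: "c t = 0" if "(\<Sum>t\<in>T. fun_scale (c t) (f t)) = 0" and "t \<in> T" for c t
    using A B V(1) inj T(2) f that
    by (rule pencil_independent[where A = A and B = B and V = V and f = f and T = T])
  have inj: "inj_on f T"
  proof (rule inj_onI, rule ccontr)
    fix s t assume st: "s \<in> T" "t \<in> T" "f s = f t" "s \<noteq> t"
    define c where "c = (\<lambda>u. if u = s then 1 else if u = t then - 1 else (0::real))"
    have "(\<Sum>u\<in>T. fun_scale (c u) (f u)) = (\<Sum>u\<in>{s, t}. fun_scale (c u) (f u))"
      using st T(2) by (intro sum.mono_neutral_right) (auto simp: c_def fun_eq_iff fun_scale_apply)
    also have "\<dots> = 0" using st by (auto simp: c_def fun_eq_iff fun_scale_apply)
    finally have "c s = 0" using st(1) by (rule indep)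
    then show False by (simp add: c_def)
  qed
  have "fun_space.independent (f ` T)"
  proof (rule fun_space.independent_if_scalars_zero)
    fix c y assume *: "(\<Sum>y\<in>f ` T. fun_scale (c y) y) = 0" "y \<in> f ` T"
    then have "(\<Sum>t\<in>T. fun_scale (c (f t)) (f t)) = 0" by (simp add: sum.reindex[OF inj])
    then show "c y = 0" using indep[of "\<lambda>t. c (f t)"] *(2) by auto
  qed (use T in auto)
  moreover have "f ` T \<subseteq> fun_space.span ((\<lambda>b x. if x = b then 1 else 0) ` X)"
    unfolding supported_basis(2)[OF V(3)] using f V(2) by auto
  ultimately have "card (f ` T) \<le> card ((\<lambda>b x. if x = b then 1 else (0::real)) ` X)"
    using V(3) by (intro fun_space.independent_span_bound[THEN conjunct2]) auto
  then show False using card_image[OF inj] T(3) supported_basis(3)[OF V(3)] by simp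
qed

section \<open>Iterated partial sums\<close>

text \<open>On generating functions, multiplication by \<open>1 / (1 - x)\<close>; correspondingly,
  \<open>shift\<close> below is multiplication by \<open>x\<close>.\<close>

definition psum :: "(nat \<Rightarrow> int) \<Rightarrow> nat \<Rightarrow> int" where
  "psum a d = (\<Sum>e\<le>d. a e)"

lemma psum_0 [simp]: "psum a 0 = a 0"
  by (simp add: psum_def)

lemma psum_Suc [simp]: "psum a (Suc d) = psum a d + a (Suc d)"
  by (simp add: psum_def)

lemma psum_funpow_mono:
  assumes "\<And>e. e \<le> d \<Longrightarrow> a e \<le> b e"
  shows "(psum ^^ n) a d \<le> (psum ^^ n) b d"
  using assms
proof (induction n arbitrary: d)
  case (Suc n)
  then have "(psum ^^ n) a e \<le> (psum ^^ n) b e" if "e \<le> d" for e using that by auto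
  then show ?case by (auto simp: psum_def[of "(psum ^^ n) _"] intro!: sum_mono)
qed auto

lemma psum_funpow_sum:
  "(psum ^^ n) (\<lambda>i. \<Sum>x\<in>A. f x i) d = (\<Sum>x\<in>A. (psum ^^ n) (f x) d)"
proof (induction n arbitrary: d)
  case (Suc n)
  have "(\<Sum>e\<le>d. \<Sum>x\<in>A. (psum ^^ n) (f x) e) = (\<Sum>x\<in>A. \<Sum>e\<le>d. (psum ^^ n) (f x) e)"
    by (rule sum.swap)
  then show ?case
    using Suc by (simp add: psum_def[of "(psum ^^ n) _"])
qed auto

text \<open>Only the top term of a partial sum is not controlled by the earlier ones.\<close>

lemma psum_funpow_le_cancel:
  assumes "\<And>e. e < d \<Longrightarrow> a e \<le> b e" and "(psum ^^ n) b d \<le> (psum ^^ n) a d"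
  shows "b d \<le> a d"
  using assms(2)
proof (induction n)
  case (Suc n)
  have "(psum ^^ n) b d \<le> (psum ^^ n) a d"
  proof (cases d)
    case 0
    then show ?thesis using Suc.prems by simp
  next
    case d: (Suc d')
    have "(psum ^^ Suc n) a d' \<le> (psum ^^ Suc n) b d'"
      using assms(1) d by (intro psum_funpow_mono) auto
    then show ?thesis using Suc.prems d by simp
  qed
  then show ?case by (rule Suc.IH)
qed auto

definition shift :: "(nat \<Rightarrow> int) \<Rightarrow> nat \<Rightarrow> int" where
  "shift a d = (if d = 0 then 0 else a (d - 1))"

lemma psum_shift: "psum (shift a) = shift (psum a)"
proof
  fix d
  show "psum (shift a) d = shift (psum a) d"
  proof (induction d)
    case (Suc d)
    then show ?case by (cases d) (auto simp: shift_def)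
  qed (auto simp: shift_def)
qed

lemma psum_funpow_shift: "(psum ^^ n) (shift a) = shift ((psum ^^ n) a)"
  by (induction n) (auto simp: psum_shift)

section \<open>The \<open>h\<close>-vector as a sum over faces\<close>

text \<open>The coefficient of \<open>x^i\<close> in \<open>x^j * (1 - x)^n\<close>. For
  \<open>j = card X\<close> and \<open>n = r - card X\<close> it is the contribution of the face
  \<open>X\<close> to the \<open>h\<close>-polynomial.\<close>

definition face_term :: "nat \<Rightarrow> nat \<Rightarrow> nat \<Rightarrow> int" where
  "face_term n j i = (if j \<le> i then (-1) ^ (i + j) * int (n choose (i - j)) else 0)"

lemma h_vector_faces:
  assumes "finite K" and "\<And>X. X \<in> K \<Longrightarrow> finite X"
  shows "h_vector r K i = (\<Sum>X\<in>K. face_term (r - card X) (card X) i)"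
proof -
  have "h_vector r K i = (\<Sum>j\<le>i. \<Sum>X\<in>{X\<in>K. card X = j}. face_term (r - card X) (card X) i)"
    unfolding h_vector_def atLeast0AtMost
    by (rule sum.cong) (auto simp: f_vector_def face_term_def)
  also have "\<dots> = (\<Sum>j\<le>i. \<Sum>X\<in>{X\<in>{X\<in>K. card X \<le> i}. card X = j}. face_term (r - card X) (card X) i)"
    by (intro sum.cong) auto
  also have "\<dots> = (\<Sum>X\<in>{X\<in>K. card X \<le> i}. face_term (r - card X) (card X) i)"
    using assms(1) by (intro sum.group) auto
  also have "\<dots> = (\<Sum>X\<in>K. face_term (r - card X) (card X) i)"
    using assms(1) by (intro sum.mono_neutral_left) (auto simp: face_term_def)
  finally show ?thesis .
qed

lemma psum_face_term: "psum (face_term (Suc n) j) = face_term n j"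
proof
  fix i
  show "psum (face_term (Suc n) j) i = face_term n j i"
  proof (induction i)
    case 0
    then show ?case by (auto simp: face_term_def)
  next
    case (Suc i)
    show ?case
    proof (cases "j \<le> i")
      case True
      then have "Suc i - j = Suc (i - j)" by simp
      then show ?thesis using Suc True by (simp add: face_term_def algebra_simps)
    next
      case False
      then show ?thesis using Suc by (cases "j = Suc i") (auto simp: face_term_def)
    qed
  qed
qed

lemma psum_funpow_face_term: "(psum ^^ n) (face_term n j) = face_term 0 j"
  by (induction n) (auto simp: psum_face_term funpow_swap1)

lemma face_term_0: "face_term 0 j i = (if i = j then 1 else 0)"
  by (cases "i = j") (auto simp: face_term_def binomial_eq_0 minus_one_power_iff)

lemma face_term_0_Suc: "face_term 0 (Suc j) = shift (face_term 0 j)"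
  by (auto simp: fun_eq_iff face_term_0 shift_def)

text \<open>The generating function is \<open>(x / (1 - x))^card X\<close>. Removing one copy of
  \<open>v\<close> from a monomial leaves one whose support either still contains \<open>v\<close>
  or has just lost it.\<close>

lemma card_multisets_support:
  assumes "finite X"
  shows "int (card {m. size m = d \<and> set_mset m = X}) = (psum ^^ card X) (face_term 0 (card X)) d"
  using assms
proof (induction X arbitrary: d rule: finite_induct)
  case empty
  have iff: "size m = d \<and> set_mset m = {} \<longleftrightarrow> m = {#} \<and> d = 0" for m :: "'a multiset"
    by (metis set_mset_eq_empty_iff size_empty)
  have "int (card {m::'a multiset. m = {#} \<and> d = 0}) = (if d = 0 then 1 else 0)"
    by (cases "d = 0") auto
  moreover have "(psum ^^ card ({}::'a set)) (face_term 0 (card ({}::'a set))) d = (if d = 0 then 1 else 0)"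
    by (simp add: face_term_0)
  ultimately show ?case unfolding iff by (simp only:)
next
  case (insert v X)
  define N where "N = (\<lambda>X d. int (card {m::'a multiset. size m = d \<and> set_mset m = X}))"
  have IH: "N X = (psum ^^ card X) (face_term 0 (card X))"
    using insert.IH by (auto simp: N_def)
  have N0: "N (insert v X) 0 = 0" by (simp add: N_def)
  have NS: "N (insert v X) (Suc d) = N (insert v X) d + N X d" for d
  proof -
    define A where "A = (\<lambda>Y d. {m::'a multiset. size m = d \<and> set_mset m = Y})"
    have fin: "finite (A Y d)" if "finite Y" for Y
      using finite_multisets_of_size[OF that, of d]
      by (rule rev_finite_subset) (auto simp: multisets_of_size_def A_def)
    have "A (insert v X) (Suc d) = add_mset v ` (A (insert v X) d \<union> A X d)"
    proof (intro equalityI subsetI)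
      fix m assume "m \<in> A (insert v X) (Suc d)"
      then have m: "size m = Suc d" "set_mset m = insert v X" by (auto simp: A_def)
      then obtain m' where m': "m = add_mset v m'" by (metis insertI1 multi_member_split)
      then have "insert v (set_mset m') = insert v X" "size m' = d" using m by auto
      then have "m' \<in> A (insert v X) d \<union> A X d"
        using insert.hyps(2) insert_ident[of v "set_mset m'" X] insert_absorb[of v "set_mset m'"]
        unfolding A_def by blast
      then show "m \<in> add_mset v ` (A (insert v X) d \<union> A X d)"
        using m' by blast
    next
      fix m assume "m \<in> add_mset v ` (A (insert v X) d \<union> A X d)"
      then obtain m' where m': "m = add_mset v m'" "m' \<in> A (insert v X) d \<union> A X d" by blast
      from m'(2) have "size m' = d" "set_mset m' = insert v X \<or> set_mset m' = X"
        unfolding A_def by blast+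
      then have "size m = Suc d" "set_mset m = insert v X"
        unfolding m'(1) by (simp, metis insert_absorb2 set_mset_add_mset_insert)
      then show "m \<in> A (insert v X) (Suc d)" unfolding A_def by blast
    qed
    moreover have "card (add_mset v ` (A (insert v X) d \<union> A X d)) = card (A (insert v X) d \<union> A X d)"
      by (rule card_image) (simp add: inj_on_def)
    moreover have "card (A (insert v X) d \<union> A X d) = card (A (insert v X) d) + card (A X d)"
      using insert.hyps by (intro card_Un_disjoint fin) (auto simp: A_def)
    moreover have "N Y d = int (card (A Y d))" for Y d by (simp add: N_def A_def)
    ultimately show ?thesis by simp
  qed
  have "N (insert v X) d = shift (psum (N X)) d" for d
  proof (induction d)
    case (Suc d)
    then show ?case using NS[of d] by (cases d) (auto simp: shift_def N0)
  qed (auto simp: N0 shift_def)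
  also have "shift (psum (N X)) d = (psum ^^ card (insert v X)) (face_term 0 (card (insert v X))) d"
    using insert.hyps by (simp add: IH face_term_0_Suc psum_funpow_shift psum_shift)
  finally show ?case by (simp add: N_def)
qed

section \<open>Stress spaces\<close>

text \<open>A multiset \<open>m\<close> of vertices stands for the monomial \<open>x\<^sup>m\<close>. The space \<open>stress E \<Delta> u n d\<close> is the
  dual of the degree \<open>d\<close> part of the face ring of \<open>\<Delta>\<close> modulo the linear forms
  \<open>\<Sum>v. u l v x\<^sub>v\<close> for \<open>l < n\<close>.\<close>

definition face_msets :: "'a set set \<Rightarrow> nat \<Rightarrow> 'a multiset set" where
  "face_msets \<Delta> d = {m. size m = d \<and> set_mset m \<in> \<Delta>}"

text \<open>The transpose of multiplication by the linear form with coefficients \<open>c\<close>: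
  if it kills \<open>f\<close>, then \<open>f\<close>, seen as a functional on polynomials, vanishes
  on all multiples of that form.\<close>

definition lin_form :: "'a set \<Rightarrow> ('a \<Rightarrow> real) \<Rightarrow> ('a multiset \<Rightarrow> real) \<Rightarrow> 'a multiset \<Rightarrow> real" where
  "lin_form E c f = (\<lambda>m. \<Sum>v\<in>E. c v * f (add_mset v m))"

definition stress ::
  "'a set \<Rightarrow> 'a set set \<Rightarrow> (nat \<Rightarrow> 'a \<Rightarrow> real) \<Rightarrow> nat \<Rightarrow> nat \<Rightarrow> ('a multiset \<Rightarrow> real) set" where
  "stress E \<Delta> u n d = {f \<in> supported (face_msets \<Delta> d). \<forall>l<n. lin_form E (u l) f = 0}"

lemma linear_lin_form: "Vector_Spaces.linear fun_scale fun_scale (lin_form E c)"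
  by (rule linear_fun_scaleI)
    (auto simp: lin_form_def fun_eq_iff fun_scale_apply algebra_simps sum.distrib sum_distrib_left)

lemma lin_form_0 [simp]: "lin_form E c 0 = 0"
  by (auto simp: lin_form_def fun_eq_iff)

lemma lin_form_add: "lin_form E c (f + g) = lin_form E c f + lin_form E c g"
  by (auto simp: lin_form_def fun_eq_iff algebra_simps sum.distrib)

lemma lin_form_scale: "lin_form E c (fun_scale a f) = fun_scale a (lin_form E c f)"
  by (auto simp: lin_form_def fun_eq_iff fun_scale_apply algebra_simps sum_distrib_left)

lemma lin_form_commute: "lin_form E c (lin_form E c' f) = lin_form E c' (lin_form E c f)"
proof
  fix m
  have "lin_form E c (lin_form E c' f) m = (\<Sum>v\<in>E. \<Sum>w\<in>E. c v * (c' w * f (add_mset w (add_mset v m))))"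
    by (simp add: lin_form_def sum_distrib_left)
  also have "\<dots> = (\<Sum>w\<in>E. \<Sum>v\<in>E. c v * (c' w * f (add_mset w (add_mset v m))))"
    by (rule sum.swap)
  also have "\<dots> = (\<Sum>w\<in>E. \<Sum>v\<in>E. c' w * (c v * f (add_mset v (add_mset w m))))"
    by (intro sum.cong) (auto simp: add_mset_commute mult.left_commute)
  also have "\<dots> = lin_form E c' (lin_form E c f) m"
    by (simp add: lin_form_def sum_distrib_left)
  finally show "lin_form E c (lin_form E c' f) m = lin_form E c' (lin_form E c f) m" .
qed

lemma subspace_stress: "fun_space.subspace (stress E \<Delta> u n d)"
proof (rule subspace_fun_scaleI)
  show "0 \<in> stress E \<Delta> u n d"
    using fun_space.subspace_0[OF subspace_supported] by (auto simp: stress_def)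
  show "f + g \<in> stress E \<Delta> u n d" if "f \<in> stress E \<Delta> u n d" "g \<in> stress E \<Delta> u n d" for f g
    using that fun_space.subspace_add[OF subspace_supported]
    by (auto simp: stress_def lin_form_add)
  show "fun_scale c f \<in> stress E \<Delta> u n d" if "f \<in> stress E \<Delta> u n d" for c f
    using that fun_space.subspace_scale[OF subspace_supported]
    by (auto simp: stress_def lin_form_scale)
qed

lemma stress_supported: "stress E \<Delta> u n d \<subseteq> supported (face_msets \<Delta> d)"
  by (auto simp: stress_def)

definition simplicial :: "'a set \<Rightarrow> 'a set set \<Rightarrow> bool" where
  "simplicial E \<Delta> \<longleftrightarrow> finite E \<and> (\<forall>X\<in>\<Delta>. X \<subseteq> E \<and> (\<forall>Y\<subseteq>X. Y \<in> \<Delta>))"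

lemma finite_face_msets: "simplicial E \<Delta> \<Longrightarrow> finite (face_msets \<Delta> d)"
  by (rule finite_subset[OF _ finite_multisets_of_size[of E d]])
    (auto simp: multisets_of_size_def face_msets_def simplicial_def)

lemma simplicial_finite: "simplicial E \<Delta> \<Longrightarrow> finite \<Delta>" "simplicial E \<Delta> \<Longrightarrow> X \<in> \<Delta> \<Longrightarrow> finite X"
  by (auto simp: simplicial_def intro: finite_subset[of \<Delta> "Pow E"] finite_subset[of X E])

lemma face_msets_add_mset:
  assumes "simplicial E \<Delta>" and "add_mset v m \<in> face_msets \<Delta> (Suc d)"
  shows "m \<in> face_msets \<Delta> d"
  using assms by (auto simp: face_msets_def simplicial_def)

lemma lin_form_stress:
  assumes "simplicial E \<Delta>" and f: "f \<in> stress E \<Delta> u n (Suc d)"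
  shows "lin_form E c f \<in> stress E \<Delta> u n d"
proof -
  have "lin_form E c f \<in> supported (face_msets \<Delta> d)"
    unfolding supported_def
  proof safe
    fix m assume "lin_form E c f m \<noteq> 0"
    then obtain v where "f (add_mset v m) \<noteq> 0"
      unfolding lin_form_def by (metis (mono_tags, lifting) mult_zero_right sum.neutral)
    then show "m \<in> face_msets \<Delta> d"
      using f face_msets_add_mset[OF assms(1)] by (auto simp: stress_def supported_def)
  qed
  moreover have "lin_form E (u l) (lin_form E c f) = 0" if "l < n" for l
    using f that by (subst lin_form_commute) (auto simp: stress_def)
  ultimately show ?thesis by (auto simp: stress_def)
qed

lemma lin_form_single:
  assumes "finite E" and "v \<in> E"
  shows "lin_form E (\<lambda>w. if w = v then 1 else 0) f = (\<lambda>m. f (add_mset v m))"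
proof
  fix m
  have "(\<Sum>w\<in>E. (if w = v then 1 else 0) * f (add_mset w m)) = (\<Sum>w\<in>E. if w = v then f (add_mset v m) else 0)"
    by (intro sum.cong) auto
  then show "lin_form E (\<lambda>w. if w = v then 1 else 0) f m = f (add_mset v m)"
    using assms by (simp add: lin_form_def)
qed

lemma inverse_system_stress:
  assumes "simplicial E \<Delta>"
  shows "inverse_system E (\<lambda>v. lin_form E (\<lambda>w. if w = v then 1 else 0)) (stress E \<Delta> u n)"
  unfolding inverse_system_def
proof (intro conjI ballI allI impI)
  show "\<exists>C. finite C \<and> stress E \<Delta> u n d \<subseteq> supported C" for d
    using finite_face_msets[OF assms, of d] stress_supported[of E \<Delta> u n d]
    by (intro exI[of _ "face_msets \<Delta> d"] conjI)
  fix f d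
  assume f: "f \<in> stress E \<Delta> u n (Suc d)"
    and 0: "\<forall>v\<in>E. lin_form E (\<lambda>w. if w = v then 1 else 0) f = 0"
  have "f m = 0" for m
  proof (rule ccontr)
    assume "f m \<noteq> 0"
    then have m: "size m = Suc d" "set_mset m \<in> \<Delta>"
      using f by (auto simp: stress_def supported_def face_msets_def)
    then obtain v m' where v: "m = add_mset v m'" by (meson size_eq_Suc_imp_eq_union)
    then have "v \<in> E" using m assms by (auto simp: simplicial_def)
    then have "f m = 0"
      using 0 lin_form_single[of E v f] v assms by (auto simp: fun_eq_iff simplicial_def)
    then show False using \<open>f m \<noteq> 0\<close> by simp
  qed
  then show "f = 0" by auto
qed (use linear_lin_form lin_form_commute subspace_stress lin_form_stress[OF assms] in auto)

lemma dim_stress_step: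
  assumes "simplicial E \<Delta>"
  shows "fun_space.dim (stress E \<Delta> u n (Suc d)) \<le>
    fun_space.dim (stress E \<Delta> u (Suc n) (Suc d)) + fun_space.dim (stress E \<Delta> u n d)"
proof -
  have "fun_space.dim (stress E \<Delta> u n (Suc d)) =
      fun_space.dim {f \<in> stress E \<Delta> u n (Suc d). lin_form E (u n) f = 0} +
      fun_space.dim (lin_form E (u n) ` stress E \<Delta> u n (Suc d))"
    by (rule fun_dim_kernel_image[OF finite_face_msets[OF assms] stress_supported subspace_stress
          linear_lin_form])
  also have "{f \<in> stress E \<Delta> u n (Suc d). lin_form E (u n) f = 0} = stress E \<Delta> u (Suc n) (Suc d)"
    by (auto simp: stress_def less_Suc_eq)
  also have "fun_space.dim (lin_form E (u n) ` stress E \<Delta> u n (Suc d)) \<le> fun_space.dim (stress E \<Delta> u n d)"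
    by (rule fun_dim_mono[OF finite_face_msets[OF assms] stress_supported])
      (use lin_form_stress[OF assms] in auto)
  finally show ?thesis by simp
qed

lemma stress_degree_0:
  assumes "simplicial E \<Delta>"
  shows "stress E \<Delta> u n 0 = stress E \<Delta> u 0 0"
proof -
  have "lin_form E c f = 0" if "f \<in> supported (face_msets \<Delta> 0)" for c f
  proof -
    have "f (add_mset v m) = 0" for v m
      using that by (auto simp: supported_def face_msets_def)
    then show ?thesis by (auto simp: lin_form_def fun_eq_iff)
  qed
  then show ?thesis by (auto simp: stress_def)
qed

text \<open>Without forms, stresses are all functions on \<open>face_msets\<close>; each further
  form costs at most one partial sum.\<close>

lemma card_face_msets_le:
  assumes "simplicial E \<Delta>"
  shows "int (card (face_msets \<Delta> d)) \<le> (psum ^^ n) (\<lambda>d. int (fun_space.dim (stress E \<Delta> u n d))) d"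
proof (induction n)
  case 0
  have "stress E \<Delta> u 0 d = supported (face_msets \<Delta> d)" by (auto simp: stress_def)
  then show ?case using dim_supported[OF finite_face_msets[OF assms]] by simp
next
  case (Suc n)
  have "int (fun_space.dim (stress E \<Delta> u n e)) \<le> psum (\<lambda>d. int (fun_space.dim (stress E \<Delta> u (Suc n) d))) e" for e
  proof (induction e)
    case 0
    then show ?case using stress_degree_0[OF assms, of u n] stress_degree_0[OF assms, of u "Suc n"] by simp
  next
    case (Suc e)
    then show ?case using dim_stress_step[OF assms, of u n e] by simp
  qed
  then have "(psum ^^ n) (\<lambda>d. int (fun_space.dim (stress E \<Delta> u n d))) d \<le>
      (psum ^^ n) (psum (\<lambda>d. int (fun_space.dim (stress E \<Delta> u (Suc n) d)))) d"
    by (intro psum_funpow_mono) auto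
  then show ?case using Suc by (simp add: funpow_swap1)
qed

text \<open>The Hilbert series of the face ring is \<open>h(x) / (1 - x)^r\<close>. For a face
  \<open>X\<close>, \<open>r - card X\<close> of the partial sums cancel the powers of
  \<open>1 - x\<close>, and the remaining ones count the monomials with support
  \<open>X\<close>.\<close>

lemma card_face_msets:
  assumes "simplicial E \<Delta>" and "\<And>X. X \<in> \<Delta> \<Longrightarrow> card X \<le> r"
  shows "int (card (face_msets \<Delta> d)) = (psum ^^ r) (h_vector r \<Delta>) d"
proof -
  note fin = simplicial_finite[OF assms(1)]
  have "(psum ^^ r) (h_vector r \<Delta>) d = (\<Sum>X\<in>\<Delta>. (psum ^^ r) (face_term (r - card X) (card X)) d)"
    unfolding psum_funpow_sum[symmetric] using h_vector_faces[OF fin, of r] by presburger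
  also have "\<dots> = (\<Sum>X\<in>\<Delta>. int (card {m. size m = d \<and> set_mset m = X}))"
  proof (rule sum.cong)
    fix X assume X: "X \<in> \<Delta>"
    have "psum ^^ r = psum ^^ card X \<circ> psum ^^ (r - card X)"
      using assms(2)[OF X] by (simp flip: funpow_add)
    then show "(psum ^^ r) (face_term (r - card X) (card X)) d = int (card {m. size m = d \<and> set_mset m = X})"
      using card_multisets_support[OF fin(2)[OF X]] by (simp add: psum_funpow_face_term)
  qed simp
  also have "\<dots> = int (card (\<Union>X\<in>\<Delta>. {m. size m = d \<and> set_mset m = X}))"
  proof (subst card_UN_disjoint)
    show "\<forall>X\<in>\<Delta>. finite {m. size m = d \<and> set_mset m = X}"
    proof
      fix X assume "X \<in> \<Delta>"
      show "finite {m. size m = d \<and> set_mset m = X}"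
        using finite_multisets_of_size[OF fin(2)[OF \<open>X \<in> \<Delta>\<close>], of d]
        by (rule rev_finite_subset) (auto simp: multisets_of_size_def)
    qed
  qed (use fin in auto)
  also have "(\<Union>X\<in>\<Delta>. {m. size m = d \<and> set_mset m = X}) = face_msets \<Delta> d"
    by (auto simp: face_msets_def)
  finally show ?thesis by simp
qed

text \<open>With the value \<open>h 0\<close> at index \<open>0\<close> these are the coefficients
  of \<open>(1 - x) * h(x)\<close>, so that partial sums recover \<open>h\<close>.\<close>

definition g_vector :: "nat \<Rightarrow> 'a set set \<Rightarrow> nat \<Rightarrow> int" where
  "g_vector r \<Delta> i = h_vector r \<Delta> i - (if i = 0 then 0 else h_vector r \<Delta> (i - 1))"

lemma psum_g_vector: "psum (g_vector r \<Delta>) = h_vector r \<Delta>"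
proof
  show "psum (g_vector r \<Delta>) i = h_vector r \<Delta> i" for i
    by (induction i) (auto simp: g_vector_def)
qed

text \<open>No generality of the \<open>r + 1\<close> linear forms is needed here: a stress space that is small in all
  degrees up to \<open>i\<close> is forced to be large in degree \<open>i + 1\<close>.\<close>

lemma g_vector_macaulay:
  assumes \<Delta>: "simplicial E \<Delta>" "\<And>X. X \<in> \<Delta> \<Longrightarrow> card X \<le> r"
    and le: "\<And>d. d \<le> i \<Longrightarrow> int (fun_space.dim (stress E \<Delta> u (Suc r) d)) \<le> g_vector r \<Delta> d"
    and "1 \<le> i"
  shows "g_vector r \<Delta> (i + 1) \<le> int (pseudo_power (nat (g_vector r \<Delta> i)) i)"
proof -
  define w where "w = (\<lambda>d. fun_space.dim (stress E \<Delta> u (Suc r) d))"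
  have "(psum ^^ Suc r) (g_vector r \<Delta>) (Suc i) \<le> (psum ^^ Suc r) (\<lambda>d. int (w d)) (Suc i)"
    using card_face_msets_le[OF \<Delta>(1), of "Suc i" "Suc r" u] card_face_msets[OF \<Delta>, of "Suc i"]
    by (simp only: funpow_Suc_right o_def psum_g_vector w_def)
  then have "g_vector r \<Delta> (Suc i) \<le> int (w (Suc i))"
    using le by (intro psum_funpow_le_cancel[where a = "\<lambda>d. int (w d)" and n = "Suc r"])
      (auto simp: w_def simp del: funpow.simps)
  then have "nat (g_vector r \<Delta> (Suc i)) \<le> w (Suc i)" by simp
  then have "min_shadow (Suc i) (nat (g_vector r \<Delta> (Suc i))) \<le> min_shadow (Suc i) (w (Suc i))"
    by (rule min_shadow_mono)
  also have "\<dots> \<le> w i"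
    using macaulay_growth[OF _ inverse_system_stress[OF \<Delta>(1)]] \<Delta>(1)
    by (auto simp: w_def simplicial_def)
  also have "w i \<le> nat (g_vector r \<Delta> i)" using le[of i] by (simp add: w_def)
  finally show ?thesis using le_pseudo_power[OF \<open>1 \<le> i\<close>] by fastforce
qed

section \<open>Series classes\<close>

context matroid
begin

lemma indep_finite: "indep X \<Longrightarrow> finite X"
  using finite_ground indep_subset_ground finite_subset by blast

lemma finite_indeps: "finite {X. indep X}"
  using finite_ground indep_subset_ground by (auto intro!: rev_finite_subset[of "Pow E"])

lemma card_le_rank: "indep X \<Longrightarrow> card X \<le> matroid_rank indep"
  unfolding matroid_rank_def using finite_indeps by (intro Max_ge) auto

lemma ex_rank: "\<exists>B. indep B \<and> card B = matroid_rank indep"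
proof -
  have "Max (card ` {X. indep X}) \<in> card ` {X. indep X}"
    using finite_indeps indep_empty by (intro Max_in) auto
  then show ?thesis by (auto simp: matroid_rank_def)
qed

lemma extend_from:
  assumes "indep X" and "indep Y" and "card X \<le> card Y"
  shows "\<exists>Z. indep Z \<and> X \<subseteq> Z \<and> Z \<subseteq> X \<union> Y \<and> card Z = card Y"
  using assms
proof (induction "card Y - card X" arbitrary: X)
  case 0
  then show ?case by (intro exI[of _ X]) auto
next
  case (Suc n)
  then obtain e where e: "e \<in> Y - X" "indep (insert e X)"
    using augmentation[of X Y] by force
  have "card (insert e X) = Suc (card X)"
    using e indep_finite[OF Suc.prems(1)] by simp
  then have "n = card Y - card (insert e X)" "card (insert e X) \<le> card Y"
    using Suc.hyps(2) by linarith+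
  then obtain Z where "indep Z" "insert e X \<subseteq> Z" "Z \<subseteq> insert e X \<union> Y" "card Z = card Y"
    using Suc.hyps(1)[of "insert e X"] e Suc.prems by blast
  then show ?case using e by (intro exI[of _ Z]) auto
qed

lemma basis_iff: "matroid_basis indep B \<longleftrightarrow> indep B \<and> card B = matroid_rank indep"
proof
  assume B: "matroid_basis indep B"
  obtain C where C: "indep C" "card C = matroid_rank indep" using ex_rank by blast
  then obtain Z where "indep Z" "B \<subseteq> Z" "card Z = card C"
    using extend_from[of B C] B card_le_rank[of B] by (auto simp: matroid_basis_def)
  then show "indep B \<and> card B = matroid_rank indep"
    using B C by (auto simp: matroid_basis_def)
next
  assume B: "indep B \<and> card B = matroid_rank indep"
  have "X = B" if "indep X" "B \<subseteq> X" for X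
    using card_seteq[OF indep_finite[OF that(1)] that(2)] card_le_rank[OF that(1)] B by auto
  then show "matroid_basis indep B" using B by (auto simp: matroid_basis_def)
qed

lemma rank_eqI:
  assumes "\<And>X. indep X \<Longrightarrow> card X \<le> k" and "indep B" and "card B = k"
  shows "matroid_rank indep = k"
  using assms card_le_rank[of B] ex_rank by force

end

locale coloop_free_matroid = matroid +
  assumes avoid_basis: "e \<in> E \<Longrightarrow> \<exists>B. indep B \<and> card B = matroid_rank indep \<and> e \<notin> B"

lemma coloop_free_matroidI:
  assumes "matroid E indep" and "\<forall>e\<in>E. \<not> coloop E indep e"
  shows "coloop_free_matroid E indep"
proof -
  interpret matroid E indep by fact
  show ?thesis
    using assms(2) by unfold_locales (auto simp: coloop_def basis_iff)
qed

text \<open>Without coloops, distinct \<open>e\<close> and \<open>f\<close> are in series when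
  \<open>{e, f}\<close> is a cocircuit, that is, when they are parallel in the dual matroid. The
  alternative \<open>f = e\<close> is separate because \<open>e\<close> alone does not meet every
  basis.\<close>

definition series_class :: "'a set \<Rightarrow> ('a set \<Rightarrow> bool) \<Rightarrow> 'a \<Rightarrow> 'a set" where
  "series_class E indep e =
     {f \<in> E. f = e \<or> (\<forall>B. indep B \<and> card B = matroid_rank indep \<longrightarrow> e \<in> B \<or> f \<in> B)}"

text \<open>Deleting the faces that contain a series class \<open>S\<close> turns \<open>S\<close> into a circuit that is a direct
  summand, while \<open>restr_link indep S\<close> is the contraction of \<open>S\<close>, with the elements of \<open>S\<close> kept as loops.\<close>

definition restr_avoid :: "('a set \<Rightarrow> bool) \<Rightarrow> 'a set \<Rightarrow> 'a set \<Rightarrow> bool" where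
  "restr_avoid indep S X \<longleftrightarrow> indep X \<and> \<not> S \<subseteq> X"

definition restr_link :: "('a set \<Rightarrow> bool) \<Rightarrow> 'a set \<Rightarrow> 'a set \<Rightarrow> bool" where
  "restr_link indep S X \<longleftrightarrow> X \<inter> S = {} \<and> indep (X \<union> S)"

context coloop_free_matroid
begin

abbreviation "rk \<equiv> matroid_rank indep"

lemma series_class_self: "e \<in> E \<Longrightarrow> e \<in> series_class E indep e"
  by (simp add: series_class_def)

lemma series_class_subset: "series_class E indep e \<subseteq> E"
  by (auto simp: series_class_def)

text \<open>Transitivity of being in series. A basis \<open>B\<close> missing both \<open>f\<close>
  and \<open>f'\<close> would contain \<open>e\<close>. Exchanging \<open>e\<close> for an element
  \<open>x\<close> of a basis that avoids \<open>e\<close> gives a basis without \<open>e\<close>;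
  it must contain both \<open>f\<close> and \<open>f'\<close>, but only \<open>x\<close> is
  new.\<close>

lemma series_class_basis:
  assumes e: "e \<in> E" and f: "f \<in> series_class E indep e" "f' \<in> series_class E indep e" "f \<noteq> f'"
    and B: "indep B" "card B = rk"
  shows "f \<in> B \<or> f' \<in> B"
proof (rule ccontr)
  assume notin: "\<not> ?thesis"
  then have "f \<noteq> e" "f' \<noteq> e" "e \<in> B"
    using f B by (auto simp: series_class_def)
  obtain B' where B': "indep B'" "card B' = rk" "e \<notin> B'" using avoid_basis[OF e] by blast
  have "finite B" using B indep_finite by blast
  then have "card (B - {e}) < card B'"
    using B B' \<open>e \<in> B\<close> by (metis card_Diff1_less)
  then obtain x where x: "x \<in> B' - (B - {e})" "indep (insert x (B - {e}))"
    using augmentation[of "B - {e}" B'] indep_subset[OF B(1)] B' by blast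
  have "card (insert x (B - {e})) = rk"
    using x(1) card_Suc_Diff1[OF \<open>finite B\<close> \<open>e \<in> B\<close>] B(2) \<open>finite B\<close> by simp
  moreover have "e \<notin> insert x (B - {e})" using x B' by auto
  ultimately have "f \<in> insert x (B - {e})" "f' \<in> insert x (B - {e})"
    using f x(2) \<open>f \<noteq> e\<close> \<open>f' \<noteq> e\<close> unfolding series_class_def by blast+
  then show False using notin f(3) by auto
qed

lemma series_class_eq:
  assumes "e \<in> E" and "f \<in> series_class E indep e"
  shows "series_class E indep f = series_class E indep e"
proof -
  have fE: "f \<in> E" using assms series_class_subset by blast
  have ef: "e \<in> series_class E indep f" using assms by (auto simp: series_class_def)
  have "x \<in> series_class E indep b" if "a \<in> E" "b \<in> series_class E indep a" "x \<in> series_class E indep a" for a b x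
    using series_class_basis[OF that(1,2,3)] that(3) by (auto simp: series_class_def)
  then show ?thesis using assms ef fE by blast
qed

text \<open>Extend \<open>X\<close> by elements of a basis that misses some \<open>f\<close> in
  \<open>S - T\<close>. The resulting basis also misses \<open>f\<close>, hence contains all other
  elements of the class.\<close>

lemma indep_union_series:
  assumes e: "e \<in> E" and S: "S = series_class E indep e"
    and X: "indep X" "X \<inter> S = {}" and T: "T \<subseteq> S" "T \<noteq> S"
  shows "indep (X \<union> T)"
proof -
  obtain f where f: "f \<in> S" "f \<notin> T" using T by blast
  then have "f \<in> E" using S series_class_subset by blast
  then obtain B where B: "indep B" "card B = rk" "f \<notin> B" using avoid_basis by blast
  then obtain Z where Z: "indep Z" "X \<subseteq> Z" "Z \<subseteq> X \<union> B" "card Z = rk"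
    using extend_from[OF X(1) B(1)] card_le_rank[OF X(1)] by auto
  have "f \<notin> Z" using Z(3) B(3) X(2) f(1) by blast
  then have "T \<subseteq> Z"
    using series_class_basis[OF e, of f _ Z] f T Z S by blast
  then show ?thesis by (intro indep_subset[OF Z(1)] Un_least Z(2))
qed

lemma indep_avoid_series:
  assumes "e \<in> E" and "S = series_class E indep e" and "indep (X - S)" and "X \<subseteq> E" and "\<not> S \<subseteq> X"
  shows "restr_avoid indep S X"
proof -
  have "indep ((X - S) \<union> (X \<inter> S))"
    using assms by (intro indep_union_series[OF assms(1,2)]) auto
  moreover have "(X - S) \<union> (X \<inter> S) = X" by blast
  ultimately have "indep X" by (simp only:)
  then show ?thesis using assms(5) by (simp add: restr_avoid_def)
qed

text \<open>Independence now means that the part outside \<open>S\<close> is independent and the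
  part inside \<open>S\<close> is proper, so augmentation happens in one of two summands. Bases that
  miss an element of \<open>S\<close> survive, which preserves the rank.\<close>

lemma coloop_free_avoid:
  assumes e: "e \<in> E" and S: "S = series_class E indep e"
  shows "coloop_free_matroid E (restr_avoid indep S)" and "matroid_rank (restr_avoid indep S) = rk"
proof -
  let ?I = "restr_avoid indep S"
  have eS: "e \<in> S" and SE: "S \<subseteq> E" using series_class_self[OF e] series_class_subset S by auto
  have fin: "finite X" if "X \<subseteq> E" for X using that finite_ground finite_subset by blast
  have M: "matroid E ?I"
  proof
    show "?I {}" using indep_empty eS by (auto simp: restr_avoid_def)
    show "?I Y" if "?I X" "Y \<subseteq> X" for X Y
      using that indep_subset by (auto simp: restr_avoid_def)
    show "X \<subseteq> E" if "?I X" for X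
      using that indep_subset_ground by (auto simp: restr_avoid_def)
    fix X Y assume X: "?I X" and Y: "?I Y" and lt: "card X < card Y"
    then have XE: "X \<subseteq> E" "Y \<subseteq> E" using indep_subset_ground by (auto simp: restr_avoid_def)
    have iX: "indep (X - S)" and iY: "indep (Y - S)"
      using X Y indep_subset by (auto simp: restr_avoid_def)
    have cX: "card X = card (X - S) + card (X \<inter> S)" and cY: "card Y = card (Y - S) + card (Y \<inter> S)"
      using fin XE by (metis Int_Diff_Un Int_Diff_disjoint add.commute card_Un_disjoint finite_Diff finite_Int)+
    show "\<exists>x\<in>Y - X. ?I (insert x X)"
    proof (cases "card (X - S) < card (Y - S)")
      case True
      then obtain x where x: "x \<in> (Y - S) - (X - S)" "indep (insert x (X - S))"
        using augmentation[OF iX iY] by blast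
      moreover have "insert x X - S = insert x (X - S)" using x by auto
      moreover have "\<not> S \<subseteq> insert x X" using X x by (auto simp: restr_avoid_def)
      ultimately have "?I (insert x X)"
        using XE by (intro indep_avoid_series[OF e S]) auto
      then show ?thesis using x by blast
    next
      case False
      then have lt': "card (X \<inter> S) < card (Y \<inter> S)" using lt cX cY by simp
      then obtain x where x: "x \<in> Y \<inter> S" "x \<notin> X"
        using card_mono[of "X \<inter> S" "Y \<inter> S"] fin[OF XE(1)] by (metis IntI Int_iff finite_Int not_le subsetI)
      have "card (Y \<inter> S) < card S"
        using Y fin[OF SE] by (intro psubset_card_mono) (auto simp: restr_avoid_def)
      moreover have "card (insert x X \<inter> S) \<le> Suc (card (X \<inter> S))"
        using x fin[OF XE(1)] by (simp add: Int_insert_left)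
      ultimately have "insert x X \<inter> S \<noteq> S" using lt' by auto
      then have "\<not> S \<subseteq> insert x X" by blast
      moreover have "insert x X - S = X - S" using x by auto
      ultimately have "?I (insert x X)"
        using XE x iX by (intro indep_avoid_series[OF e S]) auto
      then show ?thesis using x by blast
    qed
  qed (rule finite_ground)
  interpret M: matroid E ?I by (rule M)
  have avoid: "?I B" if "indep B" "x \<in> S" "x \<notin> B" for B x
    using that by (auto simp: restr_avoid_def)
  obtain B where B: "indep B" "card B = rk" "e \<notin> B" using avoid_basis[OF e] by blast
  show rank: "matroid_rank ?I = rk"
    using B avoid[OF B(1) eS B(3)] card_le_rank by (intro M.rank_eqI) (auto simp: restr_avoid_def)
  show "coloop_free_matroid E ?I"
  proof
    fix x assume x: "x \<in> E"
    show "\<exists>B. ?I B \<and> card B = matroid_rank ?I \<and> x \<notin> B"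
    proof (cases "x \<in> S")
      case True
      then show ?thesis using avoid_basis[OF x] avoid rank by metis
    next
      case False
      \<comment> \<open>Since \<open>x\<close> is not in series with \<open>e\<close>, some basis
        misses both.\<close>
      then obtain B where "indep B" "card B = rk" "e \<notin> B" "x \<notin> B"
        using x S by (auto simp: series_class_def)
      then show ?thesis using avoid eS rank by metis
    qed
  qed
qed

text \<open>A basis \<open>B\<close> missing \<open>x\<close> completes \<open>S\<close> to a basis
  inside \<open>S \<union> B\<close>. What is added to \<open>S\<close> is a basis of the
  contraction, and it lies in \<open>B\<close>, so it misses \<open>x\<close> too.\<close>

lemma coloop_free_link:
  assumes S: "indep S"
  shows "coloop_free_matroid E (restr_link indep S)"
    and "matroid_rank (restr_link indep S) + card S = rk"
proof -
  let ?I = "restr_link indep S"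
  have card: "card (X \<union> S) = card X + card S" if "?I X" for X
    using that indep_finite[of "X \<union> S"] by (auto simp: restr_link_def intro: card_Un_disjoint)
  have M: "matroid E ?I"
  proof
    show "?I {}" using S by (auto simp: restr_link_def)
    show "?I Y" if "?I X" "Y \<subseteq> X" for X Y
      using that indep_subset[of "X \<union> S" "Y \<union> S"] by (auto simp: restr_link_def)
    show "X \<subseteq> E" if "?I X" for X
      using that indep_subset_ground by (auto simp: restr_link_def)
    fix X Y assume XY: "?I X" "?I Y" "card X < card Y"
    then obtain x where "x \<in> (Y \<union> S) - (X \<union> S)" "indep (insert x (X \<union> S))"
      using augmentation[of "X \<union> S" "Y \<union> S"] card by (auto simp: restr_link_def)
    then show "\<exists>x\<in>Y - X. ?I (insert x X)"
      using XY by (intro bexI[of _ x]) (auto simp: restr_link_def)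
  qed (rule finite_ground)
  interpret M: matroid E ?I by (rule M)
  have ext: "\<exists>X. ?I X \<and> card X + card S = rk \<and> X \<subseteq> B" if B: "indep B" "card B = rk" for B
  proof -
    obtain Z where Z: "indep Z" "S \<subseteq> Z" "Z \<subseteq> S \<union> B" "card Z = rk"
      using extend_from[OF S B(1)] card_le_rank[OF S] B(2) by auto
    then have "(Z - S) \<union> S = Z" by blast
    then have "?I (Z - S)" using Z by (auto simp: restr_link_def)
    moreover have "card (Z - S) + card S = rk"
      using card[OF \<open>?I (Z - S)\<close>] \<open>(Z - S) \<union> S = Z\<close> Z by simp
    ultimately show ?thesis using Z by blast
  qed
  obtain B where "indep B" "card B = rk" using ex_rank by blast
  then obtain X where X: "?I X" "card X + card S = rk" using ext by blast
  have "matroid_rank ?I = card X"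
  proof (rule M.rank_eqI[of "card X" X])
    show "card Y \<le> card X" if "?I Y" for Y
      using card[OF that] card_le_rank[of "Y \<union> S"] that X by (auto simp: restr_link_def)
  qed (use X in auto)
  then show rank: "matroid_rank ?I + card S = rk" using X by simp
  show "coloop_free_matroid E ?I"
  proof
    fix x assume "x \<in> E"
    then obtain B where "indep B" "card B = rk" "x \<notin> B" using avoid_basis by blast
    then show "\<exists>B. ?I B \<and> card B = matroid_rank ?I \<and> x \<notin> B"
      using ext[of B] rank by fastforce
  qed
qed

lemma indeps_split:
  assumes "indep S"
  shows "{X. indep X} = {X. restr_avoid indep S X} \<union> (\<lambda>X. X \<union> S) ` {X. restr_link indep S X}"
proof (intro equalityI subsetI)
  fix X assume "X \<in> {X. indep X}"
  moreover have "X = (X - S) \<union> S" if "S \<subseteq> X" using that by blast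
  moreover have "restr_link indep S (X - S)" if "S \<subseteq> X" "indep X"
    using that by (auto simp: restr_link_def Un_absorb2)
  ultimately show "X \<in> {X. restr_avoid indep S X} \<union> (\<lambda>X. X \<union> S) ` {X. restr_link indep S X}"
    by (cases "S \<subseteq> X") (auto simp: restr_avoid_def)
qed (auto simp: restr_avoid_def restr_link_def)

lemma card_indeps_less:
  assumes "indep S" and "S \<noteq> {}"
  shows "card {X. restr_avoid indep S X} < card {X. indep X}"
    and "card {X. restr_link indep S X} < card {X. indep X}"
proof -
  have "{X. restr_avoid indep S X} \<subset> {X. indep X}"
    using assms by (auto simp: restr_avoid_def)
  then show "card {X. restr_avoid indep S X} < card {X. indep X}"
    by (rule psubset_card_mono[OF finite_indeps])
  have "{X. restr_link indep S X} \<subseteq> {X. indep X}"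
    using indep_subset by (auto simp: restr_link_def)
  moreover have "S \<notin> {X. restr_link indep S X}" using assms by (auto simp: restr_link_def)
  ultimately have "{X. restr_link indep S X} \<subset> {X. indep X}" using assms by blast
  then show "card {X. restr_link indep S X} < card {X. indep X}"
    by (rule psubset_card_mono[OF finite_indeps])
qed

lemma simplicial_indeps: "simplicial E {X. indep X}"
  using finite_ground indep_subset_ground indep_subset by (auto simp: simplicial_def)

text \<open>With \<open>s = card S\<close>, the face \<open>X \<union> S\<close> contributes
  \<open>x^(card X + s) * (1 - x)^(rk - s - card X)\<close>, which is \<open>x^s\<close> times the
  contribution of \<open>X\<close> to the contraction.\<close>

lemma h_vector_split:
  assumes S: "indep S"
  shows "h_vector rk {X. indep X} i = h_vector rk {X. restr_avoid indep S X} i +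
    (if card S \<le> i then h_vector (rk - card S) {X. restr_link indep S X} (i - card S) else 0)"
proof -
  let ?A = "{X. restr_avoid indep S X}" and ?L = "{X. restr_link indep S X}"
  have sub: "?A \<subseteq> {X. indep X}" "?L \<subseteq> {X. indep X}"
    using indep_subset by (auto simp: restr_avoid_def restr_link_def)
  then have fin: "finite ?A" "finite ?L" using finite_indeps finite_subset by blast+
  have finX: "finite X" if "X \<in> ?A \<or> X \<in> ?L" for X using that sub indep_finite by blast
  have inj: "inj_on (\<lambda>X. X \<union> S) ?L"
    by (rule inj_onI) (auto simp: restr_link_def)
  have face: "face_term (rk - card (X \<union> S)) (card (X \<union> S)) i =
      (if card S \<le> i then face_term (rk - card S - card X) (card X) (i - card S) else 0)" if "X \<in> ?L" for X
  proof -
    have c: "card (X \<union> S) = card X + card S"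
      using that finX indep_finite[OF S] by (auto simp: restr_link_def intro: card_Un_disjoint)
    have "(-1::int) ^ (i + (card X + card S)) = (-1) ^ (i - card S + card X)" if "card S \<le> i"
    proof -
      have "i + (card X + card S) = (i - card S + card X) + 2 * card S" using that by simp
      then show ?thesis by (simp only: power_add power_mult) simp
    qed
    then show ?thesis unfolding c by (auto simp: face_term_def diff_diff_left add.commute)
  qed
  have "h_vector rk {X. indep X} i =
      (\<Sum>X\<in>?A \<union> (\<lambda>X. X \<union> S) ` ?L. face_term (rk - card X) (card X) i)"
    using h_vector_faces[OF finite_indeps, of rk i] indep_finite by (simp flip: indeps_split[OF S])
  also have "\<dots> = (\<Sum>X\<in>?A. face_term (rk - card X) (card X) i) +
      (\<Sum>X\<in>(\<lambda>X. X \<union> S) ` ?L. face_term (rk - card X) (card X) i)"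
    using fin by (intro sum.union_disjoint) (auto simp: restr_avoid_def)
  also have "(\<Sum>X\<in>(\<lambda>X. X \<union> S) ` ?L. face_term (rk - card X) (card X) i) =
      (\<Sum>X\<in>?L. face_term (rk - card (X \<union> S)) (card (X \<union> S)) i)"
    by (simp add: sum.reindex[OF inj])
  also have "\<dots> = (\<Sum>X\<in>?L. if card S \<le> i then face_term (rk - card S - card X) (card X) (i - card S) else 0)"
    by (intro sum.cong refl face)
  also have "\<dots> = (if card S \<le> i then h_vector (rk - card S) ?L (i - card S) else 0)"
    using h_vector_faces[OF fin(2), of "rk - card S"] finX by simp
  also have "(\<Sum>X\<in>?A. face_term (rk - card X) (card X) i) = h_vector rk ?A i"
    using h_vector_faces[OF fin(1), of rk i] finX by simp
  finally show ?thesis .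
qed

end

text \<open>Induction on the number of independent sets, which drops in both parts because
  \<open>S\<close> itself belongs to neither. The ground set never changes, since contracted
  elements stay as loops.\<close>

lemma coloop_free_induct [consumes 1, case_names circuits step]:
  assumes "coloop_free_matroid E indep"
    and circuits: "\<And>indep. coloop_free_matroid E indep \<Longrightarrow>
      (\<And>e. e \<in> E \<Longrightarrow> \<not> indep (series_class E indep e)) \<Longrightarrow> P indep"
    and step: "\<And>indep S. coloop_free_matroid E indep \<Longrightarrow> indep S \<Longrightarrow>
      matroid_rank (restr_avoid indep S) = matroid_rank indep \<Longrightarrow>
      matroid_rank (restr_link indep S) + card S = matroid_rank indep \<Longrightarrow>
      coloop_free_matroid E (restr_link indep S) \<Longrightarrow>
      P (restr_avoid indep S) \<Longrightarrow> P (restr_link indep S) \<Longrightarrow> P indep"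
  shows "P indep"
  using assms(1)
proof (induction "card {X. indep X}" arbitrary: indep rule: less_induct)
  case less
  interpret coloop_free_matroid E indep by (rule less.prems)
  show ?case
  proof (cases "\<exists>e\<in>E. indep (series_class E indep e)")
    case False
    then show ?thesis using less.prems circuits by blast
  next
    case True
    then obtain e where e: "e \<in> E" "indep (series_class E indep e)" by blast
    define S where "S = series_class E indep e"
    have S: "indep S" "S \<noteq> {}" using e series_class_self by (auto simp: S_def)
    show ?thesis
      using coloop_free_avoid[OF e(1) S_def] coloop_free_link[OF S(1)] card_indeps_less[OF S]
        less.hyps less.prems S(1) step by blast
  qed
qed

section \<open>Direct sums of circuits\<close>

lemma coeff_face_term: "coeff (monom 1 j * [:1, -1::int:] ^ n) i = face_term n j i"
proof (cases "j \<le> i \<and> i - j \<le> n")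
  case True
  then show ?thesis
    by (simp add: coeff_monom_mult coeff_linear_poly_power face_term_def minus_one_power_iff)
next
  case False
  have "degree ([:1, -1::int:] ^ n) \<le> n" using degree_power_le[of "[:1, -1::int:]" n] by simp
  then show ?thesis
    using False by (auto simp: coeff_monom_mult face_term_def coeff_eq_0 binomial_eq_0)
qed

text \<open>The \<open>h\<close>-polynomial of a single circuit: expand
  \<open>(x + (1 - x))^card S = 1\<close>, move the term of \<open>S\<close> itself to the other
  side and divide by \<open>1 - x\<close>.\<close>

lemma proper_subsets_poly:
  assumes "finite S" and "S \<noteq> {}"
  shows "(\<Sum>X\<in>{X. X \<subset> S}. monom 1 (card X) * [:1, -1::int:] ^ (card S - 1 - card X)) =
    (\<Sum>k<card S. monom 1 k)"
proof -
  let ?x = "monom 1 1 :: int poly" and ?y = "[:1, -1::int:]"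
  have x: "?x ^ k = monom 1 k" for k by (simp add: monom_power)
  have xy: "?x + ?y = 1" "?y = 1 - ?x" by (auto simp: monom_Suc one_pCons)
  have "Pow S = insert S {X. X \<subset> S}" by auto
  moreover have "(\<Prod>s\<in>S. ?x + ?y) = (\<Sum>X\<in>Pow S. ?x ^ card X * ?y ^ (card S - card X))"
    unfolding prod_add[OF assms(1)]
  proof (intro sum.cong refl)
    fix X assume "X \<in> Pow S"
    then have "X \<subseteq> S" "finite X" using assms(1) finite_subset by auto
    then show "(\<Prod>s\<in>X. ?x) * (\<Prod>s\<in>S - X. ?y) = ?x ^ card X * ?y ^ (card S - card X)"
      by (simp only: prod_constant card_Diff_subset)
  qed
  moreover have "finite {X. X \<subset> S}" using assms(1) by (auto intro!: rev_finite_subset[of "Pow S"])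
  ultimately have "1 = ?x ^ card S + (\<Sum>X\<in>{X. X \<subset> S}. ?x ^ card X * ?y ^ (card S - card X))"
    unfolding xy by simp
  also have "(\<Sum>X\<in>{X. X \<subset> S}. ?x ^ card X * ?y ^ (card S - card X)) =
      ?y * (\<Sum>X\<in>{X. X \<subset> S}. monom 1 (card X) * ?y ^ (card S - 1 - card X))"
    unfolding sum_distrib_left
  proof (intro sum.cong refl)
    fix X assume "X \<in> {X. X \<subset> S}"
    then have "card X < card S" using assms(1) by (auto intro: psubset_card_mono)
    then have "card S - card X = Suc (card S - 1 - card X)" by simp
    then show "?x ^ card X * ?y ^ (card S - card X) = ?y * (monom 1 (card X) * ?y ^ (card S - 1 - card X))"
      unfolding x by (simp only: power_Suc mult.left_commute)
  qed
  finally have "?y * (\<Sum>X\<in>{X. X \<subset> S}. monom 1 (card X) * ?y ^ (card S - 1 - card X)) = 1 - ?x ^ card S"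
    by (simp add: algebra_simps)
  also have "\<dots> = ?y * (\<Sum>k<card S. monom 1 k)"
    using one_diff_power_eq[of ?x "card S"] by (simp only: xy(2) x)
  finally show ?thesis by (subst (asm) mult_cancel_left) auto
qed

lemma prod_monom: "(\<Prod>c\<in>A. monom (1::int) (k c)) = monom 1 (\<Sum>c\<in>A. k c)"
  by (induction A rule: infinite_finite_induct) (auto simp: mult_monom)

text \<open>A direct sum of circuits, presented by a retraction onto chosen representatives: the
  fibres are the circuits, and a fibre with one element is a loop.\<close>

locale blocks =
  fixes E :: "'a set" and rep :: "'a \<Rightarrow> 'a"
  assumes finite_E: "finite E" and rep_in: "e \<in> E \<Longrightarrow> rep e \<in> E"
    and rep_rep: "e \<in> E \<Longrightarrow> rep (rep e) = rep e"
begin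

definition "R = rep ` E"
definition "block c = {e \<in> E. rep e = c}"
definition "t c = card (block c)"
definition "rnk = card E - card R"
definition "faces = {X. X \<subseteq> E \<and> (\<forall>c\<in>R. \<not> block c \<subseteq> X)}"
text \<open>The monomial basis in degree \<open>d\<close> of the polynomial ring on \<open>R\<close>
  modulo the powers \<open>x_c^(t c)\<close>. The face ring of \<open>faces\<close> becomes this
  ring when the variables of each block are identified.\<close>

definition "box d = {q. size q = d \<and> set_mset q \<subseteq> R \<and> (\<forall>c\<in>R. count q c < t c)}"

lemma R_subset: "R \<subseteq> E" using rep_in by (auto simp: R_def)

lemma finite_R: "finite R" using R_subset finite_E finite_subset by blast

lemma rep_R: "c \<in> R \<Longrightarrow> rep c = c" using rep_rep by (auto simp: R_def)

lemma finite_block: "finite (block c)" using finite_E by (simp add: block_def)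

lemma block_self: "c \<in> R \<Longrightarrow> c \<in> block c"
  using R_subset rep_R by (auto simp: block_def)

lemma t_pos: "c \<in> R \<Longrightarrow> 0 < t c"
  using block_self finite_block by (auto simp: t_def card_gt_0_iff)

lemma card_blocks:
  assumes "X \<subseteq> E"
  shows "card X = (\<Sum>c\<in>R. card (X \<inter> block c))"
proof -
  have "X = (\<Union>c\<in>R. X \<inter> block c)" using assms by (auto simp: block_def R_def)
  then have "card X = card (\<Union>c\<in>R. X \<inter> block c)" by simp
  also have "\<dots> = (\<Sum>c\<in>R. card (X \<inter> block c))"
    using finite_R finite_block by (intro card_UN_disjoint) (auto simp: block_def)
  finally show ?thesis .
qed

lemma rnk_eq: "rnk = (\<Sum>c\<in>R. t c - 1)"
proof -
  have "card E = (\<Sum>c\<in>R. t c)"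
    using card_blocks[of E] by (simp add: t_def block_def Int_def)
  also have "\<dots> = (\<Sum>c\<in>R. (t c - 1) + 1)" using t_pos by (intro sum.cong) auto
  also have "\<dots> = (\<Sum>c\<in>R. t c - 1) + card R" by (simp only: sum.distrib) simp
  finally show ?thesis by (simp add: rnk_def)
qed

lemma faces_proper: "X \<in> faces \<Longrightarrow> c \<in> R \<Longrightarrow> X \<inter> block c \<subset> block c"
  by (auto simp: faces_def)

lemma faces_card_less: "X \<in> faces \<Longrightarrow> c \<in> R \<Longrightarrow> card (X \<inter> block c) < t c"
  unfolding t_def using faces_proper finite_block by (intro psubset_card_mono) auto

lemma rnk_diff_card:
  assumes "X \<in> faces"
  shows "rnk - card X = (\<Sum>c\<in>R. t c - 1 - card (X \<inter> block c))" and "card X \<le> rnk"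
proof -
  have X: "card X = (\<Sum>c\<in>R. card (X \<inter> block c))"
    using card_blocks assms by (auto simp: faces_def)
  have le: "card (X \<inter> block c) \<le> t c - 1" if "c \<in> R" for c
    using faces_card_less[OF assms that] by simp
  show "rnk - card X = (\<Sum>c\<in>R. t c - 1 - card (X \<inter> block c))"
    unfolding X rnk_eq using sum_subtractf_nat[of R, OF le] by simp
  show "card X \<le> rnk" unfolding X rnk_eq using le by (rule sum_mono)
qed

lemma simplicial_faces: "simplicial E faces"
  using finite_E by (auto simp: simplicial_def faces_def)

text \<open>A face is an independent choice of a proper subset of each block, so the
  \<open>h\<close>-polynomial is the product over the blocks of
  \<open>1 + x + \<dots> + x^(t c - 1)\<close>.\<close>

lemma faces_poly:
  "(\<Sum>X\<in>faces. monom 1 (card X) * [:1, -1::int:] ^ (rnk - card X)) =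
    (\<Sum>k\<in>PiE R (\<lambda>c. {..<t c}). monom 1 (\<Sum>c\<in>R. k c))"
proof -
  let ?B = "\<lambda>c. {Y. Y \<subset> block c}"
  let ?y = "[:1, -1::int:]"
  have finB: "finite (?B c)" for c using finite_block[of c] by (auto intro!: rev_finite_subset[of "Pow (block c)"])
  have "(\<Sum>X\<in>faces. monom 1 (card X) * ?y ^ (rnk - card X)) =
      (\<Sum>F\<in>PiE R ?B. \<Prod>c\<in>R. monom 1 (card (F c)) * ?y ^ (t c - 1 - card (F c)))"
  proof (rule sum.reindex_bij_witness[where i = "\<lambda>F. \<Union>c\<in>R. F c" and j = "\<lambda>X. restrict (\<lambda>c. X \<inter> block c) R"])
    fix X assume X: "X \<in> faces"
    then have XE: "X \<subseteq> E" by (auto simp: faces_def)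
    show "(\<Union>c\<in>R. restrict (\<lambda>c. X \<inter> block c) R c) = X"
      using XE by (auto simp: block_def R_def)
    show "restrict (\<lambda>c. X \<inter> block c) R \<in> PiE R ?B"
      using faces_proper[OF X] by auto
    have "(\<Prod>c\<in>R. monom 1 (card (restrict (\<lambda>c. X \<inter> block c) R c)) *
        ?y ^ (t c - 1 - card (restrict (\<lambda>c. X \<inter> block c) R c))) =
      (\<Prod>c\<in>R. monom 1 (card (X \<inter> block c)) * ?y ^ (t c - 1 - card (X \<inter> block c)))"
      by (intro prod.cong) auto
    also have "\<dots> = monom 1 (card X) * ?y ^ (rnk - card X)"
      unfolding prod.distrib prod_monom rnk_diff_card(1)[OF X] power_sum[symmetric] card_blocks[OF XE, symmetric]
      by (rule refl)
    finally show "(\<Prod>c\<in>R. monom 1 (card (restrict (\<lambda>c. X \<inter> block c) R c)) *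
        ?y ^ (t c - 1 - card (restrict (\<lambda>c. X \<inter> block c) R c))) = monom 1 (card X) * ?y ^ (rnk - card X)" .
  next
    fix F assume F: "F \<in> PiE R ?B"
    have sub: "F c \<subset> block c" if "c \<in> R" for c using F that by auto
    have Int: "(\<Union>c\<in>R. F c) \<inter> block d = F d" if "d \<in> R" for d
      using sub that by (fastforce simp: block_def)
    show "restrict (\<lambda>d. (\<Union>c\<in>R. F c) \<inter> block d) R = F"
      using F Int by (auto simp: fun_eq_iff PiE_def extensional_def)
    have "\<not> block c \<subseteq> (\<Union>c\<in>R. F c)" if "c \<in> R" for c
      using Int[OF that] sub[OF that] by blast
    moreover have "(\<Union>c\<in>R. F c) \<subseteq> E" using sub by (fastforce simp: block_def)
    ultimately show "(\<Union>c\<in>R. F c) \<in> faces" by (simp add: faces_def)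
  qed
  also have "\<dots> = (\<Prod>c\<in>R. \<Sum>Y\<in>?B c. monom 1 (card Y) * ?y ^ (t c - 1 - card Y))"
    using finite_R finB by (simp add: prod_sum_PiE)
  also have "\<dots> = (\<Prod>c\<in>R. \<Sum>k<t c. monom 1 k)"
    unfolding t_def using finite_block block_self by (intro prod.cong refl proper_subsets_poly) auto
  also have "\<dots> = (\<Sum>k\<in>PiE R (\<lambda>c. {..<t c}). \<Prod>c\<in>R. monom 1 (k c))"
    using finite_R by (simp add: prod_sum_PiE)
  finally show ?thesis unfolding prod_monom .
qed

definition "mset_of k = (\<Sum>c\<in>R. replicate_mset (k c) c)"

lemma count_mset_of: "count (mset_of k) c = (if c \<in> R then k c else 0)"
proof -
  have "count (mset_of k) c = (\<Sum>a\<in>R. if a = c then k c else 0)"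
    unfolding mset_of_def count_sum by (intro sum.cong) auto
  then show ?thesis using finite_R by simp
qed

lemma size_mset_of: "size (mset_of k) = (\<Sum>c\<in>R. k c)"
  by (simp add: mset_of_def)

lemma set_mset_of: "set_mset (mset_of k) \<subseteq> R"
  using count_mset_of by (metis count_greater_zero_iff less_irrefl subsetI)

lemma mset_of_count: "set_mset q \<subseteq> R \<Longrightarrow> mset_of (count q) = q"
  by (rule multiset_eqI) (auto simp: count_mset_of not_in_iff)

lemma size_count: "set_mset q \<subseteq> R \<Longrightarrow> size q = (\<Sum>c\<in>R. count q c)"
  using size_mset_of[of "count q"] mset_of_count by simp

lemma finite_box: "finite (box d)"
  using finite_multisets_of_size[OF finite_R, of d]
  by (rule rev_finite_subset) (auto simp: multisets_of_size_def box_def)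

lemma h_vector_faces_box: "h_vector rnk faces i = int (card (box i))"
proof -
  let ?K = "PiE R (\<lambda>c. {..<t c})"
  have fin: "finite ?K" using finite_R by (intro finite_PiE) auto
  have "h_vector rnk faces i = coeff (\<Sum>X\<in>faces. monom 1 (card X) * [:1, -1::int:] ^ (rnk - card X)) i"
    using h_vector_faces[OF simplicial_finite[OF simplicial_faces], of rnk i]
    by (simp add: coeff_sum coeff_face_term)
  also have "\<dots> = (\<Sum>k\<in>?K. if (\<Sum>c\<in>R. k c) = i then 1 else 0)"
    unfolding faces_poly coeff_sum coeff_monom by (intro sum.cong) auto
  also have "\<dots> = int (card {k \<in> ?K. (\<Sum>c\<in>R. k c) = i})"
    using fin by (simp add: sum.If_cases Int_def)
  also have "card {k \<in> ?K. (\<Sum>c\<in>R. k c) = i} = card (box i)"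
  proof (rule bij_betw_same_card)
    show "bij_betw mset_of {k \<in> ?K. (\<Sum>c\<in>R. k c) = i} (box i)"
    proof (rule bij_betwI[where g = "\<lambda>q. restrict (count q) R"])
      show "mset_of \<in> {k \<in> ?K. (\<Sum>c\<in>R. k c) = i} \<rightarrow> box i"
        using set_mset_of by (auto simp: box_def size_mset_of count_mset_of)
      show "(\<lambda>q. restrict (count q) R) \<in> box i \<rightarrow> {k \<in> ?K. (\<Sum>c\<in>R. k c) = i}"
        using size_count by (auto simp: box_def)
      show "restrict (count (mset_of k)) R = k" if "k \<in> {k \<in> ?K. (\<Sum>c\<in>R. k c) = i}" for k
        using that by (auto simp: fun_eq_iff count_mset_of PiE_def extensional_def)
      show "mset_of (restrict (count q) R) = q" if "q \<in> box i" for q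
      proof -
        have "mset_of (restrict (count q) R) = mset_of (count q)"
          unfolding mset_of_def by (intro sum.cong) auto
        then show ?thesis using that mset_of_count by (auto simp: box_def)
      qed
    qed
  qed
  finally show ?thesis .
qed

text \<open>Replace every exponent \<open>n\<close> of \<open>c\<close> by
  \<open>t c - 1 - n\<close>.\<close>

lemma card_box_symmetric:
  assumes "i \<le> rnk"
  shows "card (box i) = card (box (rnk - i))"
proof (rule bij_betw_same_card)
  define co where "co = (\<lambda>q. mset_of (\<lambda>c. t c - 1 - count q c))"
  have co: "co q \<in> box (rnk - j)" if "q \<in> box j" "j \<le> rnk" for q j
  proof -
    have le: "count q c \<le> t c - 1" if "c \<in> R" for c using \<open>q \<in> box j\<close> that by (force simp: box_def)
    have "size q = j" "set_mset q \<subseteq> R" using that by (auto simp: box_def)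
    have "size (co q) = rnk - j"
      unfolding co_def size_mset_of rnk_eq using sum_subtractf_nat[of R, OF le] size_count[of q]
        \<open>size q = j\<close> \<open>set_mset q \<subseteq> R\<close> by simp
    moreover have "count (co q) c < t c" if "c \<in> R" for c
      using t_pos[OF that] that by (simp add: co_def count_mset_of)
    ultimately show ?thesis using set_mset_of by (auto simp: box_def co_def)
  qed
  have coco: "co (co q) = q" if "q \<in> box j" for q j
  proof (rule multiset_eqI)
    fix c
    show "count (co (co q)) c = count q c"
      using that t_pos[of c] by (cases "c \<in> R") (force simp: co_def count_mset_of box_def not_in_iff)+
  qed
  show "bij_betw co (box i) (box (rnk - i))"
    using co[of _ i] co[of _ "rnk - i"] coco assms
    by (intro bij_betwI[where g = co]) auto
qed

lemma h_vector_faces_symmetric: "i \<le> rnk \<Longrightarrow> h_vector rnk faces i = h_vector rnk faces (rnk - i)"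
  unfolding h_vector_faces_box by (rule arg_cong[OF card_box_symmetric])

text \<open>\<open>lower\<close> and \<open>raise\<close> generate a representation of \<open>sl\<^sub>2\<close> on the functions on \<open>box\<close>: each block is
  an irreducible representation of dimension \<open>t c\<close>.\<close>

abbreviation "lower \<equiv> lin_form R (\<lambda>_. 1)"

definition raise :: "('a multiset \<Rightarrow> real) \<Rightarrow> 'a multiset \<Rightarrow> real" where
  "raise f q = (\<Sum>c\<in>R. real (count q c) * (real (t c) - real (count q c)) * f (q - {#c#}))"

lemma linear_raise: "Vector_Spaces.linear fun_scale fun_scale raise"
proof (rule linear_fun_scaleI)
  show "raise (f + g) = raise f + raise g" for f g
    by (rule ext) (simp add: raise_def distrib_left sum.distrib)
  show "raise (fun_scale c f) = fun_scale c (raise f)" for c f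
    by (rule ext) (simp add: raise_def fun_scale_apply sum_distrib_left mult.left_commute)
qed

lemma box_remove: "add_mset c q \<in> box (Suc d) \<Longrightarrow> q \<in> box d"
  by (auto simp: box_def split: if_splits)

lemma lower_supported: "f \<in> supported (box (Suc d)) \<Longrightarrow> lower f \<in> supported (box d)"
  unfolding supported_def
proof (safe)
  fix q assume f: "\<forall>q. f q \<noteq> 0 \<longrightarrow> q \<in> box (Suc d)" and "lower f q \<noteq> 0"
  then obtain c where "f (add_mset c q) \<noteq> 0"
    unfolding lin_form_def by (metis (mono_tags, lifting) mult_zero_right sum.neutral)
  then show "q \<in> box d" using f box_remove by blast
qed

lemma lower_supported_0: "f \<in> supported (box 0) \<Longrightarrow> lower f = 0"
  by (auto simp: supported_def box_def lin_form_def fun_eq_iff intro!: sum.neutral)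

lemma raise_supported:
  assumes f: "f \<in> supported (box d)"
  shows "raise f \<in> supported (box (Suc d))"
  unfolding supported_def
proof (safe)
  fix q assume "raise f q \<noteq> 0"
  then obtain c where c: "c \<in> R" "count q c \<noteq> 0" "count q c \<noteq> t c" "f (q - {#c#}) \<noteq> 0"
    unfolding raise_def by (smt (verit, ccfv_SIG) mult_eq_0_iff of_nat_0 sum.neutral)
  then obtain p where p: "q = add_mset c p" by (metis count_eq_zero_iff multi_member_split)
  then have "p \<in> box d" using f c by (auto simp: supported_def)
  then show "q \<in> box (Suc d)" using c p by (auto simp: box_def)
qed

text \<open>The weight \<open>n * (t c - n)\<close> vanishes at \<open>0\<close> and at
  \<open>t c\<close>, and grows by \<open>t c - 1 - 2 * n\<close> from \<open>n\<close> to
  \<open>n + 1\<close>. Terms for distinct representatives agree in both orders of composition; the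
  diagonal increments sum to \<open>rnk - 2 * d\<close>.\<close>

lemma lower_raise:
  assumes f: "f \<in> supported (box d)"
  shows "lower (raise f) = raise (lower f) + fun_scale (real rnk - 2 * real d) f"
proof
  fix q :: "'a multiset"
  define n where "n = (\<lambda>c. real (count q c))"
  have cross: "real (count (add_mset c q) c') * (real (t c') - real (count (add_mset c q) c')) *
        f (add_mset c q - {#c'#}) =
      n c' * (real (t c') - n c') * f (add_mset c (q - {#c'#})) +
      (if c = c' then (real (t c) - 1 - 2 * n c) * f q else 0)" for c c'
  proof (cases "c' \<in># q")
    case True
    then obtain p where p: "q = add_mset c' p" by (meson multi_member_split)
    show ?thesis by (cases "c = c'") (auto simp: n_def p algebra_simps add_mset_commute)
  next
    case False
    then have "n c' = 0" by (simp add: n_def not_in_iff)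
    then show ?thesis using False by (cases "c = c'") (auto simp: n_def not_in_iff)
  qed
  have "lower (raise f) q = (\<Sum>c\<in>R. \<Sum>c'\<in>R. n c' * (real (t c') - n c') * f (add_mset c (q - {#c'#})) +
      (if c = c' then (real (t c) - 1 - 2 * n c) * f q else 0))"
    unfolding lin_form_def raise_def by (simp only: cross mult_1)
  also have "\<dots> = (\<Sum>c\<in>R. \<Sum>c'\<in>R. n c' * (real (t c') - n c') * f (add_mset c (q - {#c'#}))) +
      (\<Sum>c\<in>R. (real (t c) - 1 - 2 * n c) * f q)"
    using finite_R by (simp add: sum.distrib)
  also have "(\<Sum>c\<in>R. \<Sum>c'\<in>R. n c' * (real (t c') - n c') * f (add_mset c (q - {#c'#}))) =
      (\<Sum>c'\<in>R. \<Sum>c\<in>R. n c' * (real (t c') - n c') * f (add_mset c (q - {#c'#})))"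
    by (rule sum.swap)
  also have "\<dots> = raise (lower f) q"
    by (simp add: lin_form_def raise_def n_def sum_distrib_left)
  also have "(\<Sum>c\<in>R. (real (t c) - 1 - 2 * n c) * f q) = (real rnk - 2 * real d) * f q"
  proof (cases "f q = 0")
    case False
    then have q: "size q = d" "set_mset q \<subseteq> R" using f by (auto simp: supported_def box_def)
    have "real rnk = (\<Sum>c\<in>R. real (t c) - 1)"
      unfolding rnk_eq using t_pos by (auto intro!: sum.cong simp: of_nat_diff Suc_leI)
    moreover have "real d = (\<Sum>c\<in>R. n c)"
      using size_count[OF q(2)] q(1) by (simp add: n_def)
    ultimately show ?thesis
      by (simp add: sum_subtractf sum_distrib_left flip: sum_distrib_right)
  qed simp
  finally show "lower (raise f) q = (raise (lower f) + fun_scale (real rnk - 2 * real d) f) q"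
    by (simp add: fun_scale_apply)
qed

text \<open>\<open>raise \<circ> lower\<close> has no negative eigenvalue in the lower half: applying \<open>lower\<close> to an eigenvector
  makes the eigenvalue even more negative, until degree \<open>0\<close> is reached.\<close>

lemma raise_lower_eigen:
  assumes "f \<in> supported (box d)" and "raise (lower f) = fun_scale (- l) f" and "0 < l" and "2 * d \<le> rnk"
  shows "f = 0"
  using assms
proof (induction d arbitrary: f l)
  case 0
  interpret raise: Vector_Spaces.linear fun_scale fun_scale raise by (rule linear_raise)
  have "fun_scale (- l) f = 0" using 0 lower_supported_0 raise.zero by metis
  then show ?case using 0 by simp
next
  case (Suc d)
  interpret raise: Vector_Spaces.linear fun_scale fun_scale raise by (rule linear_raise)
  define g where "g = lower f"
  define l' where "l' = l + (real rnk - 2 * real d)"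
  have g: "g \<in> supported (box d)" using lower_supported Suc.prems(1) by (simp add: g_def)
  have "lower (raise g) = lower (fun_scale (- l) f)"
    unfolding g_def Suc.prems(2) by (rule refl)
  then have "raise (lower g) + fun_scale (real rnk - 2 * real d) g = fun_scale (- l) g"
    unfolding lower_raise[OF g] lin_form_scale unfolding g_def .
  then have eigen: "raise (lower g) = fun_scale (- l') g"
    by (auto simp: fun_eq_iff fun_scale_apply l'_def algebra_simps)
  have "0 < l'" using Suc.prems(3,4) by (simp add: l'_def)
  then have "g = 0"
    by (rule Suc.IH[OF g eigen]) (use Suc.prems(4) in simp)
  then have "fun_scale (- l) f = 0" using Suc.prems(2) raise.zero unfolding g_def by metis
  then show ?case using Suc.prems(3) by simp
qed

text \<open>If \<open>lower (raise f) = 0\<close>, the commutator relation makes \<open>f\<close> an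
  eigenvector of \<open>raise \<circ> lower\<close> for the negative eigenvalue
  \<open>2 * d - rnk\<close>, so \<open>f = 0\<close>. Hence \<open>lower\<close> maps degree
  \<open>d + 1\<close> onto degree \<open>d\<close>.\<close>

lemma dim_kernel_lower:
  assumes "2 * d < rnk"
  shows "fun_space.dim {f \<in> supported (box (Suc d)). lower f = 0} + card (box d) \<le> card (box (Suc d))"
proof -
  interpret raise: Vector_Spaces.linear fun_scale fun_scale raise by (rule linear_raise)
  let ?DU = "\<lambda>f. lower (raise f)"
  have lin: "Vector_Spaces.linear fun_scale fun_scale ?DU"
    by (rule linear_fun_scaleI) (auto simp: raise.add raise.scale lin_form_add lin_form_scale)
  have inj: "f = 0" if f: "f \<in> supported (box d)" "?DU f = 0" for f
  proof (rule raise_lower_eigen[OF f(1)])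
    show "raise (lower f) = fun_scale (- (real rnk - 2 * real d)) f"
      using f(2) unfolding lower_raise[OF f(1)]
      by (auto simp: fun_eq_iff fun_scale_apply algebra_simps add_eq_0_iff)
  qed (use assms in auto)
  have "card (box d) = fun_space.dim (supported (box d))"
    by (simp add: dim_supported[OF finite_box])
  also have "\<dots> = fun_space.dim {f \<in> supported (box d). ?DU f = 0} + fun_space.dim (?DU ` supported (box d))"
    by (rule fun_dim_kernel_image[OF finite_box order_refl subspace_supported lin])
  also have "fun_space.dim {f \<in> supported (box d). ?DU f = 0} = 0"
    using inj fun_space.dim_le_card[of "{f \<in> supported (box d). ?DU f = 0}" "{}"] by auto
  also have "fun_space.dim (?DU ` supported (box d)) \<le> fun_space.dim (lower ` supported (box (Suc d)))"
    using lower_supported raise_supported by (intro fun_dim_mono[OF finite_box[of d]]) auto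
  finally have "card (box d) \<le> fun_space.dim (lower ` supported (box (Suc d)))" by simp
  moreover have "card (box (Suc d)) = fun_space.dim (supported (box (Suc d)))"
    by (simp add: dim_supported[OF finite_box])
  moreover have "fun_space.dim (supported (box (Suc d))) =
      fun_space.dim {f \<in> supported (box (Suc d)). lower f = 0} + fun_space.dim (lower ` supported (box (Suc d)))"
    by (rule fun_dim_kernel_image[OF finite_box order_refl subspace_supported linear_lin_form])
  ultimately show ?thesis by simp
qed

text \<open>For \<open>d = d' + 1\<close> the hypothesis reads \<open>2 * d' < rnk\<close>, which is
  where the bound \<open>rank + 1\<close> on \<open>2 * d\<close> comes from throughout.\<close>

lemma determines_kernel_lower:
  assumes "2 * d \<le> rnk + 1"
  shows "\<exists>K. finite K \<and> int (card K) \<le> g_vector rnk faces d \<and>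
    determines K {f \<in> supported (box d). lower f = 0}"
proof -
  let ?W = "{f \<in> supported (box d). lower f = 0}"
  have sub: "fun_space.subspace ?W"
    using subspace_supported
    by (auto intro!: subspace_fun_scaleI simp: lin_form_add lin_form_scale fun_space.subspace_def)
  have "int (fun_space.dim ?W) \<le> g_vector rnk faces d"
  proof (cases d)
    case 0
    have "fun_space.dim ?W \<le> fun_space.dim (supported (box d))"
      by (rule fun_dim_mono[OF finite_box]) auto
    then show ?thesis using 0 by (simp add: g_vector_def h_vector_faces_box dim_supported[OF finite_box])
  next
    case (Suc d')
    then show ?thesis
      using dim_kernel_lower[of d'] assms by (simp add: g_vector_def h_vector_faces_box)
  qed
  moreover obtain K where "finite K" "card K \<le> fun_space.dim ?W" "determines K ?W"
    using ex_determines[OF finite_box _ sub] by blast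
  ultimately show ?thesis by (intro exI[of _ K]) auto
qed

text \<open>The forms are \<open>x_e - x_(rep e)\<close> for the \<open>rnk\<close> elements
  \<open>e\<close> outside \<open>R\<close>, and the sum of the variables in \<open>R\<close>. The
  former make a stress depend only on the representatives of the variables; the latter puts its
  restriction to monomials on \<open>R\<close> into the kernel of \<open>lower\<close>.\<close>

lemma ex_stress_forms:
  "\<exists>u. \<forall>d. 2 * d \<le> rnk + 1 \<longrightarrow>
    (\<exists>K. finite K \<and> int (card K) \<le> g_vector rnk faces d \<and> determines K (stress E faces u (Suc rnk) d))"
proof -
  have "card (E - R) = rnk"
    using card_Diff_subset[OF finite_R R_subset] by (simp add: rnk_def)
  then obtain en where en: "bij_betw en {0..<rnk} (E - R)"
    using ex_bij_betw_nat_finite[of "E - R"] finite_E by auto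
  define u where "u = (\<lambda>l v. if l < rnk then (if v = en l then 1 else if v = rep (en l) then - 1 else 0)
    else if v \<in> R then 1 else (0::real))"
  have "\<exists>K. finite K \<and> int (card K) \<le> g_vector rnk faces d \<and> determines K (stress E faces u (Suc rnk) d)"
    if "2 * d \<le> rnk + 1" for d
  proof -
    obtain K where K: "finite K" "int (card K) \<le> g_vector rnk faces d"
      "determines K {f \<in> supported (box d). lower f = 0}"
      using determines_kernel_lower[OF \<open>2 * d \<le> rnk + 1\<close>] by blast
    have "determines K (stress E faces u (Suc rnk) d)"
      unfolding determines_def
    proof (intro ballI impI)
      fix f assume f: "f \<in> stress E faces u (Suc rnk) d" and fK: "\<forall>x\<in>K. f x = 0"
      have supp: "size m = d" "set_mset m \<in> faces" if "f m \<noteq> 0" for m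
        using f that by (auto simp: stress_def supported_def face_msets_def)
      have swap: "f (add_mset e m) = f (add_mset (rep e) m)" if "e \<in> E" for e m
      proof (cases "e \<in> R")
        case False
        then have "e \<in> en ` {0..<rnk}"
          unfolding bij_betw_imp_surj_on[OF en] using that by blast
        then obtain l where l: "l < rnk" "en l = e" by auto
        have ne: "rep e \<noteq> e" using False that by (metis R_def imageI)
        have "lin_form E (u l) f m = 0" using f l by (auto simp: stress_def)
        moreover have "lin_form E (u l) f m = (\<Sum>v\<in>E. (if v = e then f (add_mset e m) else 0) -
            (if v = rep e then f (add_mset (rep e) m) else 0))"
          unfolding lin_form_def using l ne by (intro sum.cong) (auto simp: u_def)
        moreover have "\<dots> = f (add_mset e m) - f (add_mset (rep e) m)"
          using finite_E that rep_in[OF that] by (simp add: sum_subtractf)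
        ultimately show ?thesis by simp
      qed (simp add: rep_R)
      have "f (m + m') = f (image_mset rep m + m')" if "set_mset m \<subseteq> E" for m m'
        using that
      proof (induction m arbitrary: m')
        case (add e m)
        then show ?case using swap[of e "m + m'"] add.IH[of "add_mset (rep e) m'"] by simp
      qed simp
      from this[of _ "{#}"] have f_rep: "f m = f (image_mset rep m)" if "set_mset m \<subseteq> E" for m
        using that by simp
      have f_box: "q \<in> box d" if "set_mset q \<subseteq> R" "f q \<noteq> 0" for q
      proof -
        have "count q c < t c" if "c \<in> R" for c
        proof (rule ccontr)
          assume "\<not> count q c < t c"
          then have "replicate_mset (t c) c \<subseteq># q" by (simp add: count_le_replicate_mset_subset_eq[symmetric])
          then obtain p where p: "q = p + replicate_mset (t c) c" by (metis subset_mset.diff_add)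
          \<comment> \<open>Trading \<open>t c\<close> copies of \<open>c\<close> for the elements
            of its block preserves the value of \<open>f\<close>, but puts a whole block into the
            support.\<close>
          define m where "m = p + mset_set (block c)"
          have "image_mset rep (mset_set (block c)) = image_mset (\<lambda>_. c) (mset_set (block c))"
            using finite_block by (intro image_mset_cong) (auto simp: block_def)
          then have rep_block: "image_mset rep (mset_set (block c)) = replicate_mset (t c) c"
            by (simp add: t_def image_mset_const_eq)
          have "set_mset p \<subseteq> R" using p \<open>set_mset q \<subseteq> R\<close> by auto
          then have "image_mset rep p = image_mset (\<lambda>x. x) p"
            using rep_R by (intro image_mset_cong) auto
          then have "image_mset rep m = q" using rep_block p by (simp add: m_def)
          moreover have "set_mset m \<subseteq> E"
            using \<open>set_mset p \<subseteq> R\<close> R_subset finite_block by (auto simp: m_def block_def)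
          ultimately have "f m \<noteq> 0" using f_rep \<open>f q \<noteq> 0\<close> by simp
          then have "\<not> block c \<subseteq> set_mset m" using supp \<open>c \<in> R\<close> by (auto simp: faces_def)
          then show False using finite_block by (simp add: m_def)
        qed
        then show ?thesis using that supp by (auto simp: box_def)
      qed
      define g where "g = (\<lambda>q. if set_mset q \<subseteq> R then f q else 0)"
      have "lower g = 0"
      proof
        fix q
        show "lower g q = 0 q"
        proof (cases "set_mset q \<subseteq> R")
          case True
          have "lin_form E (u rnk) f q = 0" using f by (auto simp: stress_def)
          moreover have "lin_form E (u rnk) f q = (\<Sum>v\<in>R. f (add_mset v q))"
            unfolding lin_form_def using finite_E R_subset
            by (intro sum.mono_neutral_cong_right) (auto simp: u_def)
          ultimately show ?thesis using True by (simp add: lin_form_def g_def)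
        qed (auto simp: lin_form_def g_def intro!: sum.neutral)
      qed
      moreover have "g \<in> supported (box d)"
        using f_box by (auto simp: supported_def g_def split: if_splits)
      ultimately have "g = 0"
        using fK by (intro determinesD[OF K(3)]) (auto simp: g_def)
      then have g0: "f q = 0" if "set_mset q \<subseteq> R" for q
        using that by (metis g_def zero_fun_apply)
      have "f m = 0" for m
      proof (cases "set_mset m \<subseteq> E")
        case True
        then show ?thesis using f_rep g0[of "image_mset rep m"] by (auto simp: R_def)
      next
        case False
        then show ?thesis using supp by (auto simp: faces_def)
      qed
      then show "f = 0" by auto
    qed
    then show ?thesis using K by blast
  qed
  then show ?thesis by blast
qed

end

section \<open>Generic linear forms\<close>

context coloop_free_matroid
begin

definition class_rep :: "'a \<Rightarrow> 'a" where
  "class_rep e = (SOME f. f \<in> series_class E indep e)"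

lemma class_rep_in: "e \<in> E \<Longrightarrow> class_rep e \<in> series_class E indep e"
  unfolding class_rep_def using series_class_self by (rule someI)

lemma class_rep_eq: "e \<in> E \<Longrightarrow> f \<in> series_class E indep e \<Longrightarrow> class_rep f = class_rep e"
  unfolding class_rep_def by (simp only: series_class_eq)

sublocale blocks E class_rep
proof
  show "finite E" by (rule finite_ground)
  fix e assume e: "e \<in> E"
  show "class_rep e \<in> E" using class_rep_in[OF e] series_class_subset by blast
  show "class_rep (class_rep e) = class_rep e" by (rule class_rep_eq[OF e class_rep_in[OF e]])
qed

lemma block_class_rep:
  assumes e: "e \<in> E"
  shows "block (class_rep e) = series_class E indep e"
proof (intro equalityI subsetI)
  fix f assume "f \<in> block (class_rep e)"
  then have f: "f \<in> E" "class_rep f = class_rep e" by (auto simp: block_def)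
  then have "series_class E indep f = series_class E indep e"
    using series_class_eq[OF e class_rep_in[OF e]] series_class_eq[OF f(1) class_rep_in[OF f(1)]] by simp
  then show "f \<in> series_class E indep e" using series_class_self[OF f(1)] by simp
next
  fix f assume f: "f \<in> series_class E indep e"
  then show "f \<in> block (class_rep e)"
    using class_rep_eq[OF e f] series_class_subset by (auto simp: block_def)
qed

lemma faces_eq: "faces = {X. X \<subseteq> E \<and> (\<forall>e\<in>E. \<not> series_class E indep e \<subseteq> X)}"
  by (auto simp: faces_def R_def block_class_rep)

text \<open>From a set that contains no full class, remove the class of one of its elements; the
  rest is independent by induction, and \<open>indep_avoid_series\<close> restores the removed
  part.\<close>

lemma circuits_faces:
  assumes circ: "\<And>e. e \<in> E \<Longrightarrow> \<not> indep (series_class E indep e)"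
  shows "{X. indep X} = faces" and "matroid_rank indep = rnk"
proof -
  have "indep X" if "X \<in> faces" for X
    using that
  proof (induction "card X" arbitrary: X rule: less_induct)
    case less
    then have X: "X \<subseteq> E" by (simp add: faces_eq)
    show ?case
    proof (cases "X = {}")
      case False
      then obtain e where e: "e \<in> X" "e \<in> E" using X by blast
      let ?S = "series_class E indep e"
      have "X - ?S \<in> faces" using less.prems by (auto simp: faces_eq)
      moreover have "card (X - ?S) < card X"
        using e series_class_self[OF e(2)] finite_subset[OF X finite_ground]
        by (intro psubset_card_mono) auto
      ultimately have "indep (X - ?S)" using less.hyps by blast
      moreover have "\<not> ?S \<subseteq> X" using less.prems e by (auto simp: faces_eq)
      ultimately show ?thesis
        using indep_avoid_series[OF e(2) refl] X by (simp add: restr_avoid_def)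
    qed (simp add: indep_empty)
  qed
  moreover have "X \<in> faces" if "indep X" for X
    using that circ indep_subset indep_subset_ground by (auto simp: faces_eq)
  ultimately show eq: "{X. indep X} = faces" by blast
  have "\<not> block c \<subseteq> E - R" if "c \<in> R" for c using block_self[OF that] that by blast
  then have "E - R \<in> faces" by (auto simp: faces_def)
  moreover have "card (E - R) = rnk"
    using card_Diff_subset[OF finite_R R_subset] by (simp add: rnk_def)
  ultimately show "matroid_rank indep = rnk"
    using eq rnk_diff_card(2) by (intro rank_eqI) auto
qed

end

text \<open>On the functions that vanish on \<open>K\<close>, determination is injectivity of the
  operator \<open>T\<close>, which bundles all \<open>n\<close> forms into one by indexing its
  values with pairs of a form and a monomial. As \<open>T\<close> is linear in the forms, a line of
  forms gives a pencil.\<close>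

lemma finite_not_determines:
  fixes u w :: "nat \<Rightarrow> 'a \<Rightarrow> real"
  assumes "simplicial E \<Delta>" and det: "determines K (stress E \<Delta> u n d)"
  shows "finite {x. \<not> determines K (stress E \<Delta> (\<lambda>l v. u l v + x * w l v) n d)}"
proof -
  define V where "V = {f \<in> supported (face_msets \<Delta> d). \<forall>x\<in>K. f x = 0}"
  define T where "T = (\<lambda>c f (l, m). if l < n then lin_form E (c l) f m else 0)"
  have lin: "Vector_Spaces.linear fun_scale fun_scale (T c)" for c
    by (rule linear_fun_scaleI)
      (auto simp: T_def fun_eq_iff lin_form_add lin_form_scale fun_scale_apply)
  have sub: "fun_space.subspace V"
    using subspace_supported unfolding V_def
    by (auto intro!: subspace_fun_scaleI simp: fun_space.subspace_def fun_scale_apply)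
  have T0: "T c f = 0 \<longleftrightarrow> (\<forall>l<n. lin_form E (c l) f = 0)" for c f
    by (auto simp: T_def fun_eq_iff)
  have "f = 0" if "f \<in> V" "T u f = 0" for f
    using that det unfolding T0 by (auto simp: V_def stress_def determines_def)
  then have fin: "finite {x. \<exists>f\<in>V. f \<noteq> 0 \<and> T u f + fun_scale x (T w f) = 0}"
    using finite_face_msets[OF assms(1)] by (intro finite_pencil_kernel lin sub) (auto simp: V_def)
  have T_add: "T u f + fun_scale x (T w f) = T (\<lambda>l v. u l v + x * w l v) f" for x f
    by (auto simp: T_def fun_eq_iff fun_scale_apply lin_form_def algebra_simps sum.distrib sum_distrib_left)
  show ?thesis
  proof (rule finite_subset[OF _ fin], safe)
    fix x assume "\<not> determines K (stress E \<Delta> (\<lambda>l v. u l v + x * w l v) n d)"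
    then obtain f where "f \<in> stress E \<Delta> (\<lambda>l v. u l v + x * w l v) n d" "\<forall>x\<in>K. f x = 0" "f \<noteq> 0"
      by (auto simp: determines_def)
    then show "\<exists>f\<in>V. f \<noteq> 0 \<and> T u f + fun_scale x (T w f) = 0"
      unfolding T_add T0 by (intro bexI[of _ f]) (auto simp: V_def stress_def)
  qed
qed

text \<open>By the dimension counts this forces the first \<open>r\<close> forms to be a linear system of parameters,
  and the last one to act injectively on the quotient in the lower half: it is a \<open>g\<close>-element.\<close>

definition g_generic :: "'a set \<Rightarrow> ('a set \<Rightarrow> bool) \<Rightarrow> (nat \<Rightarrow> 'a \<Rightarrow> real) \<Rightarrow> bool" where
  "g_generic E indep u \<longleftrightarrow> (\<forall>d. 2 * d \<le> matroid_rank indep + 1 \<longrightarrow>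
     (\<exists>K. finite K \<and> int (card K) \<le> g_vector (matroid_rank indep) {X. indep X} d \<and>
        determines K (stress E {X. indep X} u (Suc (matroid_rank indep)) d)))"

context coloop_free_matroid
begin

lemma g_vector_split:
  assumes S: "indep S"
  shows "g_vector rk {X. indep X} d = g_vector rk {X. restr_avoid indep S X} d +
    (if card S \<le> d then g_vector (rk - card S) {X. restr_link indep S X} (d - card S) else 0)"
  using h_vector_split[OF S, of d] h_vector_split[OF S, of "d - 1"]
  by (cases "card S \<le> d"; cases "d = card S") (auto simp: g_vector_def diff_commute)

text \<open>The function \<open>m \<mapsto> f (m + mset_set S)\<close> is a stress on the star of
  \<open>S\<close>, so \<open>L\<close> forces it to vanish. Then \<open>f\<close> lives on faces
  that do not contain \<open>S\<close>, and \<open>K\<close> takes over.\<close>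

lemma determines_split:
  assumes S: "indep S"
    and K: "determines K (stress E {X. restr_avoid indep S X} u n d)"
    and L: "card S \<le> d \<Longrightarrow> determines L (stress E {X. indep (X \<union> S)} u n (d - card S))"
  shows "determines (K \<union> (\<lambda>m. m + mset_set S) ` L) (stress E {X. indep X} u n d)"
  unfolding determines_def
proof (intro ballI impI)
  fix f assume f: "f \<in> stress E {X. indep X} u n d"
    and 0: "\<forall>m \<in> K \<union> (\<lambda>m. m + mset_set S) ` L. f m = 0"
  have finS: "finite S" using S indep_finite by blast
  have supp: "size m = d" "indep (set_mset m)" if "f m \<noteq> 0" for m
    using f that by (auto simp: stress_def supported_def face_msets_def)
  define g where "g = (\<lambda>m. f (m + mset_set S))"
  have "g = 0"
  proof (cases "card S \<le> d")
    case True
    have "g \<in> supported (face_msets {X. indep (X \<union> S)} (d - card S))"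
      using supp finS by (force simp: supported_def face_msets_def g_def)
    moreover have "lin_form E (u l) g = 0" if "l < n" for l
    proof
      fix m
      have "lin_form E (u l) f (m + mset_set S) = 0" using f that by (auto simp: stress_def)
      then show "lin_form E (u l) g m = 0 m" by (simp add: lin_form_def g_def)
    qed
    ultimately have "g \<in> stress E {X. indep (X \<union> S)} u n (d - card S)" by (simp add: stress_def)
    then show ?thesis using 0 by (intro determinesD[OF L[OF True]]) (auto simp: g_def)
  next
    case False
    have "g m = 0" for m
      using supp(1)[of "m + mset_set S"] False by (auto simp: g_def)
    then show ?thesis by auto
  qed
  have "f m = 0" if "S \<subseteq> set_mset m" for m
  proof -
    have "mset_set S \<subseteq># m"
      using that finS by (metis finite_set_mset mset_set_set_mset_msubset subset_imp_msubset_mset_set subset_mset.order_trans)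
    then have "f m = g (m - mset_set S)" by (simp add: g_def)
    then show ?thesis using \<open>g = 0\<close> by simp
  qed
  then have "f \<in> stress E {X. restr_avoid indep S X} u n d"
    using f supp by (fastforce simp: stress_def supported_def face_msets_def restr_avoid_def)
  then show "f = 0" using 0 by (intro determinesD[OF K]) auto
qed

text \<open>The star is the join of the contraction with the simplex on \<open>S\<close>. Spending
  \<open>card S\<close> of the \<open>rk + 1\<close> forms on the variables of \<open>S\<close>
  kills these variables and leaves exactly the number of forms that the contraction
  requires.\<close>

lemma ex_star_forms:
  assumes S: "indep S" and u: "g_generic E (restr_link indep S) u"
  shows "\<exists>u. \<forall>d. 2 * d + card S \<le> rk + 1 \<longrightarrow>
    (\<exists>K. finite K \<and> int (card K) \<le> g_vector (rk - card S) {X. restr_link indep S X} d \<and>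
      determines K (stress E {X. indep (X \<union> S)} u (Suc rk) d))"
proof -
  define s where "s = card S"
  have finS: "finite S" using S indep_finite by blast
  have SE: "S \<subseteq> E" using S indep_subset_ground by blast
  have rk: "matroid_rank (restr_link indep S) + s = rk"
    using coloop_free_link(2)[OF S] by (simp add: s_def)
  obtain en where en: "bij_betw en {0..<s} S"
    using ex_bij_betw_nat_finite[OF finS] by (auto simp: s_def)
  define w where "w = (\<lambda>l. if l < s then (\<lambda>v. if v = en l then 1 else 0) else u (l - s))"
  have sub: "stress E {X. indep (X \<union> S)} w (Suc rk) d \<subseteq>
      stress E {X. restr_link indep S X} u (Suc (matroid_rank (restr_link indep S))) d" for d
  proof
    fix f assume f: "f \<in> stress E {X. indep (X \<union> S)} w (Suc rk) d"
    have forms: "lin_form E (w l) f = 0" if "l < Suc rk" for l using f that by (auto simp: stress_def)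
    have f0: "f (add_mset e m) = 0" if "e \<in> S" for e m
    proof -
      have "e \<in> en ` {0..<s}" unfolding bij_betw_imp_surj_on[OF en] by (rule that)
      then obtain l where l: "l < s" "en l = e" by auto
      have "lin_form E (w l) f = 0" using l rk by (intro forms) auto
      moreover have "lin_form E (w l) f = (\<lambda>m. f (add_mset e m))"
        using lin_form_single[of E e f] l SE that finite_ground by (auto simp: w_def)
      ultimately show ?thesis by (metis zero_fun_apply)
    qed
    have "f m = 0" if "e \<in> S" "e \<in># m" for e m
      using f0[OF that(1)] that(2) by (metis multi_member_split)
    then have "f \<in> supported (face_msets {X. restr_link indep S X} d)"
      using f by (fastforce simp: stress_def supported_def face_msets_def restr_link_def)
    moreover have "lin_form E (u l) f = 0" if "l < Suc (matroid_rank (restr_link indep S))" for l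
      using forms[of "l + s"] that rk by (simp add: w_def)
    ultimately show "f \<in> stress E {X. restr_link indep S X} u (Suc (matroid_rank (restr_link indep S))) d"
      by (auto simp: stress_def)
  qed
  have rk': "rk - card S = matroid_rank (restr_link indep S)" using rk by (simp add: s_def)
  have "\<exists>K. finite K \<and> int (card K) \<le> g_vector (rk - card S) {X. restr_link indep S X} d \<and>
      determines K (stress E {X. indep (X \<union> S)} w (Suc rk) d)" if "2 * d + card S \<le> rk + 1" for d
  proof -
    have "2 * d \<le> matroid_rank (restr_link indep S) + 1" using that rk by (simp add: s_def)
    then obtain K where "finite K" "int (card K) \<le> g_vector (rk - card S) {X. restr_link indep S X} d"
      "determines K (stress E {X. restr_link indep S X} u (Suc (matroid_rank (restr_link indep S))) d)"
      using u unfolding g_generic_def rk' by blast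
    then show ?thesis using sub[of d] by (auto simp: determines_def)
  qed
  then show ?thesis by blast
qed

text \<open>Both parts of the split are controlled by some choice of forms; on the line joining the two
  choices, all but finitely many points control both at once.\<close>

lemma g_generic_split:
  assumes S: "indep S" and rank: "matroid_rank (restr_avoid indep S) = rk"
    and u: "g_generic E (restr_avoid indep S) u" and u': "g_generic E (restr_link indep S) u'"
  shows "\<exists>u. g_generic E indep u"
proof -
  let ?A = "{X. restr_avoid indep S X}" and ?L = "{X. restr_link indep S X}"
  let ?St = "{X. indep (X \<union> S)}"
  obtain w where w: "\<And>d. 2 * d + card S \<le> rk + 1 \<Longrightarrow>
      \<exists>K. finite K \<and> int (card K) \<le> g_vector (rk - card S) ?L d \<and> determines K (stress E ?St w (Suc rk) d)"
    using ex_star_forms[OF S u'] by blast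
  have A: "simplicial E ?A" and St: "simplicial E ?St"
  proof -
    show "simplicial E ?A"
      using simplicial_indeps by (auto simp: simplicial_def restr_avoid_def)
    show "simplicial E ?St"
      unfolding simplicial_def
    proof (intro conjI ballI allI impI)
      show "X \<subseteq> E" if "X \<in> ?St" for X
        using that indep_subset_ground[of "X \<union> S"] by simp
      show "Y \<in> ?St" if "X \<in> ?St" "Y \<subseteq> X" for X Y
        using that indep_subset[of "X \<union> S" "Y \<union> S"] by auto
    qed (rule finite_ground)
  qed
  have "\<exists>K. \<forall>d. 2 * d \<le> rk + 1 \<longrightarrow> finite (K d) \<and> int (card (K d)) \<le> g_vector rk ?A d \<and>
      determines (K d) (stress E ?A u (Suc rk) d)"
    using u unfolding g_generic_def rank by (intro choice) auto
  then obtain K where K: "\<And>d. 2 * d \<le> rk + 1 \<Longrightarrow> finite (K d)"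
    "\<And>d. 2 * d \<le> rk + 1 \<Longrightarrow> int (card (K d)) \<le> g_vector rk ?A d"
    "\<And>d. 2 * d \<le> rk + 1 \<Longrightarrow> determines (K d) (stress E ?A u (Suc rk) d)"
    by blast
  have "\<exists>L. \<forall>d. 2 * d + card S \<le> rk + 1 \<longrightarrow> finite (L d) \<and> int (card (L d)) \<le> g_vector (rk - card S) ?L d \<and>
      determines (L d) (stress E ?St w (Suc rk) d)"
    using w by (intro choice) auto
  then obtain L where L: "\<And>d. 2 * d + card S \<le> rk + 1 \<Longrightarrow> finite (L d)"
    "\<And>d. 2 * d + card S \<le> rk + 1 \<Longrightarrow> int (card (L d)) \<le> g_vector (rk - card S) ?L d"
    "\<And>d. 2 * d + card S \<le> rk + 1 \<Longrightarrow> determines (L d) (stress E ?St w (Suc rk) d)"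
    by blast
  \<comment> \<open>The line passes through \<open>u\<close> at \<open>x = 0\<close> and
    \<open>w\<close> at \<open>x = 1\<close>; for the star it is parametrised from its other end, by
    \<open>1 - x\<close>.\<close>
  define z where "z = (\<lambda>x l v. u l v + x * (w l v - u l v))"
  define bad where "bad = (\<Union>d\<in>{d. 2 * d \<le> rk + 1}. {x. \<not> determines (K d) (stress E ?A (z x) (Suc rk) d)})
    \<union> (\<Union>d\<in>{d. 2 * d + card S \<le> rk + 1}. {x. \<not> determines (L d) (stress E ?St (z x) (Suc rk) d)})"
  have "finite {x. \<not> determines (K d) (stress E ?A (z x) (Suc rk) d)}" if "2 * d \<le> rk + 1" for d
    unfolding z_def by (rule finite_not_determines[OF A K(3)[OF that]])
  moreover have "finite {x. \<not> determines (L d) (stress E ?St (z x) (Suc rk) d)}"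
    if "2 * d + card S \<le> rk + 1" for d
  proof -
    have z': "z x = (\<lambda>l v. w l v + (1 - x) * (u l v - w l v))" for x
      by (auto simp: z_def fun_eq_iff algebra_simps)
    have "finite {y. \<not> determines (L d) (stress E ?St (\<lambda>l v. w l v + y * (u l v - w l v)) (Suc rk) d)}"
      by (rule finite_not_determines[OF St L(3)[OF that]])
    then have "finite ((\<lambda>y. 1 - y) ` {y. \<not> determines (L d) (stress E ?St (\<lambda>l v. w l v + y * (u l v - w l v)) (Suc rk) d)})"
      by (rule finite_imageI)
    moreover have "{x. \<not> determines (L d) (stress E ?St (z x) (Suc rk) d)} \<subseteq>
        (\<lambda>y. 1 - y) ` {y. \<not> determines (L d) (stress E ?St (\<lambda>l v. w l v + y * (u l v - w l v)) (Suc rk) d)}"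
    proof
      fix x assume "x \<in> {x. \<not> determines (L d) (stress E ?St (z x) (Suc rk) d)}"
      then show "x \<in> (\<lambda>y. 1 - y) ` {y. \<not> determines (L d) (stress E ?St (\<lambda>l v. w l v + y * (u l v - w l v)) (Suc rk) d)}"
        unfolding z' by (intro image_eqI[of _ _ "1 - x"]) auto
    qed
    ultimately show ?thesis by (rule rev_finite_subset)
  qed
  moreover have "finite {d. 2 * d \<le> rk + 1}" "finite {d. 2 * d + card S \<le> rk + 1}"
    by (auto intro!: finite_subset[of _ "{..rk + 1}"])
  ultimately have "finite bad" by (simp add: bad_def)
  then obtain x where "x \<notin> bad" using ex_new_if_finite[OF infinite_UNIV_char_0] by blast
  then have zK: "determines (K d) (stress E ?A (z x) (Suc rk) d)" if "2 * d \<le> rk + 1" for d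
    using that by (auto simp: bad_def)
  have zL: "determines (L d) (stress E ?St (z x) (Suc rk) d)" if "2 * d + card S \<le> rk + 1" for d
    using that \<open>x \<notin> bad\<close> by (auto simp: bad_def)
  have "g_generic E indep (z x)"
    unfolding g_generic_def
  proof (intro allI impI)
    fix d assume d: "2 * d \<le> rk + 1"
    define L' where "L' = (if card S \<le> d then L (d - card S) else {})"
    \<comment> \<open>Twice the degree falls by \<open>2 * card S\<close>, the rank of the
      contraction only by \<open>card S\<close>, so the degree stays in the admissible
      range.\<close>
    have d': "2 * (d - card S) + card S \<le> rk + 1" if "card S \<le> d" using that d by simp
    have "determines (K d \<union> (\<lambda>m. m + mset_set S) ` L') (stress E {X. indep X} (z x) (Suc rk) d)"
      using zK[OF d] zL[OF d'] by (intro determines_split[OF S]) (auto simp: L'_def)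
    moreover have "finite (K d \<union> (\<lambda>m. m + mset_set S) ` L')"
      using K(1)[OF d] L(1)[OF d'] by (auto simp: L'_def)
    moreover have "int (card (K d \<union> (\<lambda>m. m + mset_set S) ` L')) \<le> g_vector rk {X. indep X} d"
    proof -
      have "card (K d \<union> (\<lambda>m. m + mset_set S) ` L') \<le> card (K d) + card ((\<lambda>m. m + mset_set S) ` L')"
        by (rule card_Un_le)
      also have "card ((\<lambda>m. m + mset_set S) ` L') \<le> card L'"
        using L(1)[OF d'] by (intro card_image_le) (auto simp: L'_def)
      finally show ?thesis
        using K(2)[OF d] L(2)[OF d'] unfolding g_vector_split[OF S] by (auto simp: L'_def)
    qed
    ultimately show "\<exists>K. finite K \<and> int (card K) \<le> g_vector rk {X. indep X} d \<and>
        determines K (stress E {X. indep X} (z x) (Suc rk) d)" by blast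
  qed
  then show ?thesis by blast
qed

end

lemma ex_g_generic:
  assumes "coloop_free_matroid E indep"
  shows "\<exists>u. g_generic E indep u"
  using assms
proof (induction rule: coloop_free_induct)
  case (circuits indep)
  interpret coloop_free_matroid E indep by fact
  show ?case
    using ex_stress_forms circuits_faces[OF circuits(2)] by (simp add: g_generic_def)
next
  case (step indep S)
  then show ?case using coloop_free_matroid.g_generic_split by blast
qed

section \<open>Monotonicity and reflection inequalities for the \<open>h\<close>-vector\<close>

lemma g_vector_nonneg:
  assumes "coloop_free_matroid E indep" and "2 * d \<le> matroid_rank indep + 1"
  shows "0 \<le> g_vector (matroid_rank indep) {X. indep X} d"
  using ex_g_generic[OF assms(1)] assms(2) unfolding g_generic_def by (meson of_nat_0_le_iff order.trans)

lemma h_vector_unimodal: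
  assumes "coloop_free_matroid E indep" and "a \<le> b" and "2 * b \<le> matroid_rank indep + 1"
  shows "h_vector (matroid_rank indep) {X. indep X} a \<le> h_vector (matroid_rank indep) {X. indep X} b"
  using assms(2,3)
proof (induction b rule: dec_induct)
  case (step b)
  then show ?case
    using g_vector_nonneg[OF assms(1), of "Suc b"] by (simp add: g_vector_def)
qed simp

text \<open>Direct sums of circuits give equality. In a splitting, the faces avoiding
  \<open>S\<close> keep the rank and follow by induction, but the contraction enters with a shift:
  its entry \<open>i - s\<close> has to be compared with its entry \<open>q - i\<close>, and this
  combines reflection with monotonicity.\<close>

lemma h_vector_flip:
  assumes "coloop_free_matroid E indep" and "2 * i \<le> matroid_rank indep"
  shows "h_vector (matroid_rank indep) {X. indep X} i \<le>
    h_vector (matroid_rank indep) {X. indep X} (matroid_rank indep - i)"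
  using assms
proof (induction arbitrary: i rule: coloop_free_induct)
  case (circuits indep)
  interpret coloop_free_matroid E indep by fact
  show ?case
    using circuits_faces[OF circuits(2)] h_vector_faces_symmetric[of i] circuits(3) by simp
next
  case (step indep S)
  interpret coloop_free_matroid E indep by fact
  define q where "q = matroid_rank (restr_link indep S)"
  define s where "s = card S"
  let ?hL = "h_vector q {X. restr_link indep S X}"
  have rk: "rk = q + s" using step by (simp add: q_def s_def)
  have uni: "?hL a \<le> ?hL b" if "a \<le> b" "2 * b \<le> q + 1" for a b
    unfolding q_def by (rule h_vector_unimodal[OF step(5) that[unfolded q_def]])
  have flip: "?hL j \<le> ?hL (q - j)" if "2 * j \<le> q" for j
    using step(7)[of j] that by (simp add: q_def)
  \<comment> \<open>Used when \<open>i < s\<close>, where the contraction contributes only to the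
    right-hand side.\<close>
  have nonneg: "0 \<le> ?hL j" if "j \<le> q" for j
  proof -
    have h0: "0 \<le> ?hL 0" using g_vector_nonneg[OF step(5), of 0] by (simp add: q_def g_vector_def)
    show ?thesis
    proof (cases "2 * j \<le> q")
      case True
      have "?hL 0 \<le> ?hL j" by (rule uni) (use True in auto)
      then show ?thesis using h0 by linarith
    next
      case False
      then have le: "2 * (q - j) \<le> q" by simp
      have "?hL 0 \<le> ?hL (q - j)" by (rule uni) (use le in auto)
      also have "\<dots> \<le> ?hL (q - (q - j))" by (rule flip[OF le])
      finally show ?thesis using h0 \<open>j \<le> q\<close> by simp
    qed
  qed
  have link: "(if s \<le> i then ?hL (i - s) else 0) \<le> (if s \<le> rk - i then ?hL (rk - i - s) else 0)"
  proof (cases "s \<le> i")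
    case True
    have i: "2 * i \<le> q + s" using step.prems rk by simp
    then have eq: "rk - i - s = q - i" "i \<le> q" "s \<le> rk - i" using True rk by auto
    \<comment> \<open>Either \<open>q - i\<close> is in the lower half, and monotonicity suffices
      because \<open>i - s \<le> q - i\<close>; or \<open>i\<close> is, and one first climbs from
      \<open>i - s\<close> to \<open>i\<close> and then reflects.\<close>
    have "?hL (i - s) \<le> ?hL (q - i)"
    proof (cases "2 * (q - i) \<le> q")
      case True
      then show ?thesis using i \<open>s \<le> i\<close> by (intro uni) auto
    next
      case False
      then have le: "2 * i \<le> q" using eq by simp
      have "?hL (i - s) \<le> ?hL i" by (rule uni) (use le in auto)
      also have "\<dots> \<le> ?hL (q - i)" by (rule flip[OF le])
      finally show ?thesis .
    qed
    then show ?thesis using True eq by simp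
  next
    case False
    then show ?thesis using nonneg[of "rk - i - s"] rk by auto
  qed
  have q: "rk - s = q" using rk by simp
  have avoid: "h_vector rk {X. restr_avoid indep S X} i \<le> h_vector rk {X. restr_avoid indep S X} (rk - i)"
    using step(6)[of i] step(3) step.prems by simp
  show ?case
    unfolding h_vector_split[OF step(2)] s_def[symmetric] q by (rule add_mono[OF avoid link])
qed

theorem theorem4p3:
  fixes E :: "'a set" and indep :: "'a set \<Rightarrow> bool"
    and r :: nat and h g :: "nat \<Rightarrow> int"
  assumes "matroid E indep"
    and "matroid_rank indep = r"
    and "\<forall>e\<in>E. \<not> coloop E indep e"
  defines "h \<equiv> h_vector r (independence_complex indep)"
    and "g \<equiv> (\<lambda>i. h i - h (i - 1))"
  shows "(\<forall>i < r div 2. h i \<le> h (i + 1)) \<and>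
    (\<forall>i. 2 * i \<le> r \<longrightarrow> h i \<le> h (r - i)) \<and>
    (\<forall>i. 1 \<le> i \<and> 2 * i < r \<longrightarrow> g (i + 1) \<le> int (pseudo_power (nat (g i)) i))"
proof -
  have cf: "coloop_free_matroid E indep" using assms(1,3) by (rule coloop_free_matroidI)
  interpret coloop_free_matroid E indep by (rule cf)
  have h: "h = h_vector (matroid_rank indep) {X. indep X}"
    using assms(2) by (simp add: h_def independence_complex_def)
  \<comment> \<open>At \<open>i = 0\<close> the two differ: truncated subtraction gives
    \<open>g 0 = 0\<close>, whereas \<open>g_vector\<close> has \<open>h 0\<close> there.\<close>
  have g: "g i = g_vector r {X. indep X} i" if "1 \<le> i" for i
    using that assms(2) by (simp add: g_def g_vector_def h)
  obtain u where u: "g_generic E indep u" using ex_g_generic[OF cf] by blast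
  have "g (i + 1) \<le> int (pseudo_power (nat (g i)) i)" if i: "1 \<le> i" "2 * i < r" for i
  proof -
    have "int (fun_space.dim (stress E {X. indep X} u (Suc r) d)) \<le> g_vector r {X. indep X} d"
      if "d \<le> i" for d
    proof -
      have "2 * d \<le> r + 1" using that i by simp
      then obtain K where "finite K" "int (card K) \<le> g_vector r {X. indep X} d"
        "determines K (stress E {X. indep X} u (Suc r) d)"
        using u unfolding g_generic_def assms(2) by blast
      moreover from this have "fun_space.dim (stress E {X. indep X} u (Suc r) d) \<le> card K"
        using dim_le_determines[OF finite_face_msets[OF simplicial_indeps] stress_supported subspace_stress]
        by blast
      ultimately show ?thesis by linarith
    qed
    then have "g_vector r {X. indep X} (i + 1) \<le> int (pseudo_power (nat (g_vector r {X. indep X} i)) i)"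
      using card_le_rank assms(2) i by (intro g_vector_macaulay[OF simplicial_indeps]) auto
    then show ?thesis using g[of i] g[of "i + 1"] i by simp
  qed
  moreover have "h i \<le> h (i + 1)" if "i < r div 2" for i
    unfolding h using that assms(2) by (intro h_vector_unimodal[OF cf]) auto
  moreover have "h i \<le> h (r - i)" if "2 * i \<le> r" for i
    using h_vector_flip[OF cf] that assms(2) unfolding h by simp
  ultimately show ?thesis by blast
qed

end
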